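(* Let $(M,\lambda_{(i)}(x,y))$ be a GAP-space equipped with a non-linear connection $N^\alpha_\mu$, and let $|$, $||$ be the $h$- and $v$-covariant derivatives of its canonical $d$-connection. Let $\widetilde{\mathcal R}_{\sigma\nu}:=\widetilde R^\alpha_{\alpha\sigma\nu}$, $\widehat{\mathcal R}_{\sigma\nu}:=\widehat R^\alpha_{\alpha\sigma\nu}$, $\mathring{\mathcal R}_{\sigma\nu}:=\mathring R^\alpha_{\alpha\sigma\nu}$ and $\widetilde{\mathcal S}_{\sigma\nu}:=\widetilde S^\alpha_{\alpha\sigma\nu}$, $\widehat{\mathcal S}_{\sigma\nu}:=\widehat S^\alpha_{\alpha\sigma\nu}$, $\mathring{\mathcal S}_{\sigma\nu}:=\mathring S^\alpha_{\alpha\sigma\nu}$ be the contractions of the $h$- and $v$-curvature tensors of the dual, symmetric and Riemannian $d$-connections. Then (a) $\widetilde{\mathcal R}_{\sigma\nu}=\beta_{\sigma|\nu}-\beta_{\nu|\sigma}+\beta_\epsilon\Lambda^\epsilon_{\sigma\nu}+B_\epsilon R^\epsilon_{\sigma\nu}$; (b) $\widetilde{\mathcal S}_{\sigma\nu}=B_{\sigma||\nu}-B_{\nu||\sigma}+B_\epsilon T^\epsilon_{\sigma\nu}$; (c) $\widehat{\mathcal R}_{\sigma\nu}=\tfrac12\widetilde{\mathcal R}_{\sigma\nu}$; (d) $\widehat{\mathcal S}_{\sigma\nu}=\tfrac12\widetilde{\mathcal S}_{\sigma\nu}$; (e) $\mathring{\mathcal R}_{\sigma\nu}=\mathring{\mathcal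 S}_{\sigma\nu}=0$.
   Context: $M$ is a $C^\infty$ manifold of dimension $n$, $\pi:TM\to M$ its tangent bundle with induced local coordinates $(x^\mu,y^\mu)$; $\partial_\mu=\partial/\partial x^\mu$, $\dot\partial_\mu=\partial/\partial y^\mu$. All objects are smooth in $(x,y)$. Summation convention on repeated Greek and repeated Latin indices. A non-linear connection is a system of functions $N^\alpha_\beta(x,y)$ on induced charts of $TM$ transforming by $N^{\alpha'}_{\beta'}=p^{\alpha'}_{\alpha}p^{\beta}_{\beta'}N^\alpha_\beta+p^{\alpha'}_{\epsilon}p^{\epsilon}_{\beta'\sigma'}y^{\sigma'}$, where $p^{\alpha'}_{\alpha}=\partial x^{\alpha'}/\partial x^{\alpha}$, $p^{\epsilon}_{\beta'\sigma'}=\partial^2x^\epsilon/\partial x^{\beta'}\partial x^{\sigma'}$; set $\delta_\mu=\partial_\mu-N^\alpha_\mu\dot\partial_\alpha$ and $R^\alpha_{\sigma\mu}:=\delta_\mu N^\alpha_\sigma-\delta_\sigma N^\alpha_\mu$ (curvature of $N$). A GAP-space is a manifold $M$ together with $n$ global linearly independent sections $\lambda_{(i)}=(\lambda_{(i)}^\alpha(x,y))$ of the pullback bundle $\pi^{-1}(TM)$; $(\lambda_{(i)\alpha})$ is the inverse matrix ($\lambda_{(i)}^\alpha\lambda_{(i)\beta}=\delta^\alpha_\beta$, $\lambda_{(i)}^\alpha\lambda_{(j)\alpha}=\delta_{ij}$), and $g_{\mu\nu}=\lambda_{(i)\mu}\lambda_{(i)\nu}$ its metric, with inverse $g^{\mu\nu}$.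 $d$-connections (all with the same $N$): - canonical $D=(N,\Gamma,C)$: $\Gamma^\alpha_{\mu\nu}=\lambda_{(i)}^\alpha\delta_\nu\lambda_{(i)\mu}$, $C^\alpha_{\mu\nu}=\lambda_{(i)}^\alpha\dot\partial_\nu\lambda_{(i)\mu}$; - Riemannian $\mathring D=(N,\mathring\Gamma,\mathring C)$: $\mathring\Gamma^\alpha_{\mu\nu}=\tfrac12g^{\alpha\epsilon}(\delta_\mu g_{\nu\epsilon}+\delta_\nu g_{\mu\epsilon}-\delta_\epsilon g_{\mu\nu})$, $\mathring C^\alpha_{\mu\nu}=\tfrac12g^{\alpha\epsilon}(\dot\partial_\mu g_{\nu\epsilon}+\dot\partial_\nu g_{\mu\epsilon}-\dot\partial_\epsilon g_{\mu\nu})$; - dual $\widetilde D=(N,\widetilde\Gamma,\widetilde C)$: $\widetilde\Gamma^\alpha_{\mu\nu}=\Gamma^\alpha_{\nu\mu}$, $\widetilde C^\alpha_{\mu\nu}=C^\alpha_{\nu\mu}$; - symmetric $\widehat D=(N,\widehat\Gamma,\widehat C)$: $\widehat\Gamma^\alpha_{\mu\nu}=\tfrac12(\Gamma^\alpha_{\mu\nu}+\Gamma^\alpha_{\nu\mu})$, $\widehat C^\alpha_{\mu\nu}=\tfrac12(C^\alpha_{\mu\nu}+C^\alpha_{\nu\mu})$. For a $d$-connection $(N,\Gamma,C)$ the $h$- and $v$-covariant derivatives are $A^\alpha_{\mu|\nu}=\delta_\nu A^\alpha_\mu+A^\epsilon_\mu\Gamma^\alpha_{\epsilon\nu}-A^\alpha_\epsilon\Gamma^\epsilon_{\mu\nu}$,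 $A^\alpha_{\mu||\nu}=\dot\partial_\nu A^\alpha_\mu+A^\epsilon_\mu C^\alpha_{\epsilon\nu}-A^\alpha_\epsilon C^\epsilon_{\mu\nu}$ (similarly for other tensor types), and its $h$- and $v$-curvature tensors are $$R^\alpha_{\nu\mu\sigma}=\delta_\sigma\Gamma^\alpha_{\nu\mu}-\delta_\mu\Gamma^\alpha_{\nu\sigma}+\Gamma^\epsilon_{\nu\mu}\Gamma^\alpha_{\epsilon\sigma}-\Gamma^\epsilon_{\nu\sigma}\Gamma^\alpha_{\epsilon\mu}+C^\alpha_{\nu\epsilon}R^\epsilon_{\mu\sigma},$$ $$S^\alpha_{\nu\mu\sigma}=\dot\partial_\sigma C^\alpha_{\nu\mu}-\dot\partial_\mu C^\alpha_{\nu\sigma}+C^\epsilon_{\nu\mu}C^\alpha_{\epsilon\sigma}-C^\epsilon_{\nu\sigma}C^\alpha_{\epsilon\mu}.$$ The curvature tensors of $\widetilde D,\widehat D,\mathring D$ are obtained by using their own coefficients and carry the corresponding decoration. Tensors of the canonical $d$-connection: $\Lambda^\alpha_{\mu\nu}=\Gamma^\alpha_{\mu\nu}-\Gamma^\alpha_{\nu\mu}$, $T^\alpha_{\mu\nu}=C^\alpha_{\mu\nu}-C^\alpha_{\nu\mu}$, $\beta_\mu=\Lambda^\epsilon_{\mu\epsilon}$, $B_\mu=T^\epsilon_{\mu\epsilon}$. *)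

theory Defs
  imports "HOL-Analysis.Analysis"
begin

section \<open>Smooth manifolds given by an atlas\<close>

text \<open>\<open>smooth_on S f\<close> is meant for open \<open>S\<close>: all iterated directional derivatives exist,
  are differentiable and continuous on \<open>S\<close>.\<close>

fun Ck_on :: "nat \<Rightarrow> 'v::real_normed_vector set \<Rightarrow> ('v \<Rightarrow> 'w::real_normed_vector) \<Rightarrow> bool" where
  "Ck_on 0 S f \<longleftrightarrow> continuous_on S f"
| "Ck_on (Suc k) S f \<longleftrightarrow>
     (\<forall>x\<in>S. f differentiable at x) \<and> (\<forall>v. Ck_on k S (\<lambda>x. frechet_derivative f (at x) v))"

definition smooth_on :: "'v::real_normed_vector set \<Rightarrow> ('v \<Rightarrow> 'w::real_normed_vector) \<Rightarrow> bool" where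
  "smooth_on S f \<longleftrightarrow> (\<forall>k. Ck_on k S f)"

text \<open>A chart is its domain together with its coordinate map, which is only relevant on the domain.\<close>

type_synonym ('a, 'n) chart = "'a set \<times> ('a \<Rightarrow> real^'n)"

definition chart_image :: "('a, 'n::finite) chart \<Rightarrow> (real^'n) set" where
  "chart_image c = snd c ` fst c"

definition transition :: "('a, 'n::finite) chart \<Rightarrow> ('a, 'n) chart \<Rightarrow> real^'n \<Rightarrow> real^'n" where
  "transition c c' x = snd c' (inv_into (fst c) (snd c) x)"

text \<open>The atlas \<open>A\<close> need not be maximal. The dimension is \<open>CARD('n)\<close>.\<close>

definition smooth_manifold :: "'a topology \<Rightarrow> ('a, 'n::finite) chart set \<Rightarrow> bool" where
  "smooth_manifold M A \<longleftrightarrow>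
     Hausdorff_space M \<and>
     (\<exists>B. countable B \<and> (\<forall>V\<in>B. openin M V) \<and>
          (\<forall>U p. openin M U \<and> p \<in> U \<longrightarrow> (\<exists>V\<in>B. p \<in> V \<and> V \<subseteq> U))) \<and>
     (\<Union>c\<in>A. fst c) = topspace M \<and>
     (\<forall>c\<in>A. openin M (fst c) \<and> open (chart_image c) \<and>
        homeomorphic_map (subtopology M (fst c)) (top_of_set (chart_image c)) (snd c)) \<and>
     (\<forall>c\<in>A. \<forall>c'\<in>A. smooth_on (snd c ` (fst c \<inter> fst c')) (transition c c'))"

section \<open>The tangent bundle and its induced coordinates\<close>

definition partial :: "'n \<Rightarrow> (real^'n::finite \<Rightarrow> real) \<Rightarrow> real^'n \<Rightarrow> real" where
  "partial \<mu> f x = frechet_derivative f (at x) (axis \<mu> 1)"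

text \<open>With \<open>x\<close> the coordinates of \<open>c\<close> and \<open>x'\<close> those of \<open>c'\<close>, \<open>jac c c' a' a x\<close> is
  \<open>\<partial>x'\<^sup>a\<^sup>'/\<partial>x\<^sup>a\<close>, and \<open>hess c c' a' a b x\<close> is \<open>\<partial>\<^sup>2x'\<^sup>a\<^sup>'/\<partial>x\<^sup>a\<partial>x\<^sup>b\<close>.\<close>

definition jac :: "('a, 'n::finite) chart \<Rightarrow> ('a, 'n) chart \<Rightarrow> 'n \<Rightarrow> 'n \<Rightarrow> real^'n \<Rightarrow> real" where
  "jac c c' a' a = partial a (\<lambda>x. transition c c' x $ a')"

definition hess :: "('a, 'n::finite) chart \<Rightarrow> ('a, 'n) chart \<Rightarrow> 'n \<Rightarrow> 'n \<Rightarrow> 'n \<Rightarrow> real^'n \<Rightarrow> real" where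
  "hess c c' a' a b = partial a (partial b (\<lambda>x. transition c c' x $ a'))"

text \<open>A tangent vector at \<open>p\<close> is the family of its coordinate vectors in all charts of the atlas
  around \<open>p\<close>, extended by \<open>0\<close> to the other values of the chart type.\<close>

type_synonym ('a, 'n) tvec = "('a, 'n) chart \<Rightarrow> real^'n"

definition tangent_space :: "('a, 'n::finite) chart set \<Rightarrow> 'a \<Rightarrow> ('a, 'n) tvec set" where
  "tangent_space A p = {v.
     (\<forall>c\<in>A. \<forall>c'\<in>A. p \<in> fst c \<inter> fst c' \<longrightarrow>
        (\<forall>a'. v c' $ a' = (\<Sum>a\<in>UNIV. jac c c' a' a (snd c p) * v c $ a))) \<and>
     (\<forall>c. c \<notin> A \<or> p \<notin> fst c \<longrightarrow> v c = 0)}"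

definition TM :: "'a topology \<Rightarrow> ('a, 'n::finite) chart set \<Rightarrow> ('a \<times> ('a, 'n) tvec) set" where
  "TM M A = (SIGMA p:topspace M. tangent_space A p)"

definition induced_dom ::
    "'a topology \<Rightarrow> ('a, 'n::finite) chart set \<Rightarrow> ('a, 'n) chart \<Rightarrow> ('a \<times> ('a, 'n) tvec) set" where
  "induced_dom M A c = {u \<in> TM M A. fst u \<in> fst c}"

definition induced_coord ::
    "('a, 'n::finite) chart \<Rightarrow> 'a \<times> ('a, 'n) tvec \<Rightarrow> (real^'n) \<times> (real^'n)" where
  "induced_coord c u = (snd c (fst u), snd u c)"

text \<open>Local functions of the induced coordinates \<open>(x, y)\<close>.\<close>

type_synonym 'n lfun = "(real^'n) \<times> (real^'n) \<Rightarrow> real"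

section \<open>GAP-spaces and non-linear connections\<close>

text \<open>\<open>components M A c s \<alpha> (x, y)\<close> is the component \<open>s\<^sup>\<alpha>(x,y)\<close>, in the induced chart of \<open>c\<close>, of a
  section \<open>s\<close> of the pullback bundle.\<close>

definition components :: "'a topology \<Rightarrow> ('a, 'n::finite) chart set \<Rightarrow> ('a, 'n) chart \<Rightarrow>
    ('a \<times> ('a, 'n) tvec \<Rightarrow> ('a, 'n) tvec) \<Rightarrow> 'n \<Rightarrow> 'n lfun" where
  "components M A c s \<alpha> z = s (inv_into (induced_dom M A c) (induced_coord c) z) c $ \<alpha>"

definition pullback_section :: "'a topology \<Rightarrow> ('a, 'n::finite) chart set \<Rightarrow>
    ('a \<times> ('a, 'n) tvec \<Rightarrow> ('a, 'n) tvec) \<Rightarrow> bool" where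
  "pullback_section M A s \<longleftrightarrow>
     (\<forall>u\<in>TM M A. s u \<in> tangent_space A (fst u)) \<and>
     (\<forall>c\<in>A. \<forall>\<alpha>. smooth_on (chart_image c \<times> UNIV) (components M A c s \<alpha>))"

definition gap_space :: "'a topology \<Rightarrow> ('a, 'n::finite) chart set \<Rightarrow>
    ('n \<Rightarrow> 'a \<times> ('a, 'n) tvec \<Rightarrow> ('a, 'n) tvec) \<Rightarrow> bool" where
  "gap_space M A lam \<longleftrightarrow>
     smooth_manifold M A \<and>
     (\<forall>i. pullback_section M A (lam i)) \<and>
     (\<forall>u\<in>TM M A. \<forall>a :: 'n \<Rightarrow> real.
        (\<forall>c. (\<Sum>i\<in>UNIV. a i *\<^sub>R lam i u c) = 0) \<longrightarrow> (\<forall>i. a i = 0))"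

text \<open>\<open>N c \<alpha> \<beta>\<close> is \<open>N\<^sup>\<alpha>\<^sub>\<beta>\<close> in the chart induced by \<open>c\<close>.\<close>

definition nonlinear_connection :: "'a topology \<Rightarrow> ('a, 'n::finite) chart set \<Rightarrow>
    (('a, 'n) chart \<Rightarrow> 'n \<Rightarrow> 'n \<Rightarrow> 'n lfun) \<Rightarrow> bool" where
  "nonlinear_connection M A N \<longleftrightarrow>
     (\<forall>c\<in>A. \<forall>\<alpha> \<beta>. smooth_on (chart_image c \<times> UNIV) (N c \<alpha> \<beta>)) \<and>
     (\<forall>c\<in>A. \<forall>c'\<in>A. \<forall>u \<in> induced_dom M A c \<inter> induced_dom M A c'. \<forall>\<alpha>' \<beta>'.
        N c' \<alpha>' \<beta>' (induced_coord c' u) =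
          (\<Sum>\<alpha>\<in>UNIV. \<Sum>\<beta>\<in>UNIV. jac c c' \<alpha>' \<alpha> (snd c (fst u)) * jac c' c \<beta> \<beta>' (snd c' (fst u))
             * N c \<alpha> \<beta> (induced_coord c u))
          + (\<Sum>\<epsilon>\<in>UNIV. \<Sum>\<sigma>'\<in>UNIV. jac c c' \<alpha>' \<epsilon> (snd c (fst u)) * hess c' c \<epsilon> \<beta>' \<sigma>' (snd c' (fst u))
             * snd u c' $ \<sigma>'))"

section \<open>d-connections in an induced chart\<close>

definition d_x :: "'n \<Rightarrow> 'n::finite lfun \<Rightarrow> 'n lfun" where
  "d_x \<mu> f z = frechet_derivative f (at z) (axis \<mu> 1, 0)"

definition d_y :: "'n \<Rightarrow> 'n::finite lfun \<Rightarrow> 'n lfun" where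
  "d_y \<mu> f z = frechet_derivative f (at z) (0, axis \<mu> 1)"

definition delta :: "('n \<Rightarrow> 'n \<Rightarrow> 'n lfun) \<Rightarrow> 'n \<Rightarrow> 'n::finite lfun \<Rightarrow> 'n lfun" where
  "delta N \<mu> f z = d_x \<mu> f z - (\<Sum>\<alpha>\<in>UNIV. N \<alpha> \<mu> z * d_y \<alpha> f z)"

definition N_curvature :: "('n \<Rightarrow> 'n \<Rightarrow> 'n::finite lfun) \<Rightarrow> 'n \<Rightarrow> 'n \<Rightarrow> 'n \<Rightarrow> 'n lfun" where
  "N_curvature N \<alpha> \<sigma> \<mu> z = delta N \<mu> (N \<alpha> \<sigma>) z - delta N \<sigma> (N \<alpha> \<mu>) z"

text \<open>In all coefficients the upper index comes first.\<close>

datatype 'n d_connection = DConn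
  (Nco: "'n \<Rightarrow> 'n \<Rightarrow> 'n lfun")
  (Hco: "'n \<Rightarrow> 'n \<Rightarrow> 'n \<Rightarrow> 'n lfun")
  (Vco: "'n \<Rightarrow> 'n \<Rightarrow> 'n \<Rightarrow> 'n lfun")

text \<open>\<open>L i \<alpha>\<close> stands for the components \<open>\<lambda>\<^sub>(\<^sub>i\<^sub>)\<^sup>\<alpha>\<close> and \<open>coframe L i \<alpha>\<close> for \<open>\<lambda>\<^sub>(\<^sub>i\<^sub>)\<^sub>\<alpha>\<close>.\<close>

definition coframe :: "('n \<Rightarrow> 'n \<Rightarrow> 'n::finite lfun) \<Rightarrow> 'n \<Rightarrow> 'n \<Rightarrow> 'n lfun" where
  "coframe L i \<alpha> z = matrix_inv (\<chi> j \<beta>. L j \<beta> z) $ \<alpha> $ i"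

definition metric :: "('n \<Rightarrow> 'n \<Rightarrow> 'n::finite lfun) \<Rightarrow> 'n \<Rightarrow> 'n \<Rightarrow> 'n lfun" where
  "metric L \<mu> \<nu> z = (\<Sum>i\<in>UNIV. coframe L i \<mu> z * coframe L i \<nu> z)"

definition inv_metric :: "('n \<Rightarrow> 'n \<Rightarrow> 'n::finite lfun) \<Rightarrow> 'n \<Rightarrow> 'n \<Rightarrow> 'n lfun" where
  "inv_metric L \<mu> \<nu> z = matrix_inv (\<chi> \<alpha> \<beta>. metric L \<alpha> \<beta> z) $ \<mu> $ \<nu>"

definition canonical_conn ::
    "('n \<Rightarrow> 'n \<Rightarrow> 'n::finite lfun) \<Rightarrow> ('n \<Rightarrow> 'n \<Rightarrow> 'n lfun) \<Rightarrow> 'n d_connection" where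
  "canonical_conn N L = DConn N
     (\<lambda>\<alpha> \<mu> \<nu> z. \<Sum>i\<in>UNIV. L i \<alpha> z * delta N \<nu> (coframe L i \<mu>) z)
     (\<lambda>\<alpha> \<mu> \<nu> z. \<Sum>i\<in>UNIV. L i \<alpha> z * d_y \<nu> (coframe L i \<mu>) z)"

definition riemannian_conn ::
    "('n \<Rightarrow> 'n \<Rightarrow> 'n::finite lfun) \<Rightarrow> ('n \<Rightarrow> 'n \<Rightarrow> 'n lfun) \<Rightarrow> 'n d_connection" where
  "riemannian_conn N L = DConn N
     (\<lambda>\<alpha> \<mu> \<nu> z. 1/2 * (\<Sum>\<epsilon>\<in>UNIV. inv_metric L \<alpha> \<epsilon> z *
        (delta N \<mu> (metric L \<nu> \<epsilon>) z + delta N \<nu> (metric L \<mu> \<epsilon>) z - delta N \<epsilon> (metric L \<mu> \<nu>) z)))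
     (\<lambda>\<alpha> \<mu> \<nu> z. 1/2 * (\<Sum>\<epsilon>\<in>UNIV. inv_metric L \<alpha> \<epsilon> z *
        (d_y \<mu> (metric L \<nu> \<epsilon>) z + d_y \<nu> (metric L \<mu> \<epsilon>) z - d_y \<epsilon> (metric L \<mu> \<nu>) z)))"

definition dual_conn :: "'n::finite d_connection \<Rightarrow> 'n d_connection" where
  "dual_conn D = DConn (Nco D) (\<lambda>\<alpha> \<mu> \<nu>. Hco D \<alpha> \<nu> \<mu>) (\<lambda>\<alpha> \<mu> \<nu>. Vco D \<alpha> \<nu> \<mu>)"

definition symmetric_conn :: "'n::finite d_connection \<Rightarrow> 'n d_connection" where
  "symmetric_conn D = DConn (Nco D)
     (\<lambda>\<alpha> \<mu> \<nu> z. 1/2 * (Hco D \<alpha> \<mu> \<nu> z + Hco D \<alpha> \<nu> \<mu> z))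
     (\<lambda>\<alpha> \<mu> \<nu> z. 1/2 * (Vco D \<alpha> \<mu> \<nu> z + Vco D \<alpha> \<nu> \<mu> z))"

text \<open>Covariant derivatives of covector fields: \<open>h_cov D w \<mu> \<nu>\<close> is \<open>w\<^sub>\<mu>\<^sub>|\<^sub>\<nu>\<close> and
  \<open>v_cov D w \<mu> \<nu>\<close> is \<open>w\<^sub>\<mu>\<^sub>|\<^sub>|\<^sub>\<nu>\<close>.\<close>

definition h_cov :: "'n::finite d_connection \<Rightarrow> ('n \<Rightarrow> 'n lfun) \<Rightarrow> 'n \<Rightarrow> 'n \<Rightarrow> 'n lfun" where
  "h_cov D w \<mu> \<nu> z = delta (Nco D) \<nu> (w \<mu>) z - (\<Sum>\<epsilon>\<in>UNIV. w \<epsilon> z * Hco D \<epsilon> \<mu> \<nu> z)"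

definition v_cov :: "'n::finite d_connection \<Rightarrow> ('n \<Rightarrow> 'n lfun) \<Rightarrow> 'n \<Rightarrow> 'n \<Rightarrow> 'n lfun" where
  "v_cov D w \<mu> \<nu> z = d_y \<nu> (w \<mu>) z - (\<Sum>\<epsilon>\<in>UNIV. w \<epsilon> z * Vco D \<epsilon> \<mu> \<nu> z)"

definition h_curvature :: "'n::finite d_connection \<Rightarrow> 'n \<Rightarrow> 'n \<Rightarrow> 'n \<Rightarrow> 'n \<Rightarrow> 'n lfun" where
  "h_curvature D \<alpha> \<nu> \<mu> \<sigma> z =
     delta (Nco D) \<sigma> (Hco D \<alpha> \<nu> \<mu>) z - delta (Nco D) \<mu> (Hco D \<alpha> \<nu> \<sigma>) z
     + (\<Sum>\<epsilon>\<in>UNIV. Hco D \<epsilon> \<nu> \<mu> z * Hco D \<alpha> \<epsilon> \<sigma> z)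
     - (\<Sum>\<epsilon>\<in>UNIV. Hco D \<epsilon> \<nu> \<sigma> z * Hco D \<alpha> \<epsilon> \<mu> z)
     + (\<Sum>\<epsilon>\<in>UNIV. Vco D \<alpha> \<nu> \<epsilon> z * N_curvature (Nco D) \<epsilon> \<mu> \<sigma> z)"

definition v_curvature :: "'n::finite d_connection \<Rightarrow> 'n \<Rightarrow> 'n \<Rightarrow> 'n \<Rightarrow> 'n \<Rightarrow> 'n lfun" where
  "v_curvature D \<alpha> \<nu> \<mu> \<sigma> z =
     d_y \<sigma> (Vco D \<alpha> \<nu> \<mu>) z - d_y \<mu> (Vco D \<alpha> \<nu> \<sigma>) z
     + (\<Sum>\<epsilon>\<in>UNIV. Vco D \<epsilon> \<nu> \<mu> z * Vco D \<alpha> \<epsilon> \<sigma> z)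
     - (\<Sum>\<epsilon>\<in>UNIV. Vco D \<epsilon> \<nu> \<sigma> z * Vco D \<alpha> \<epsilon> \<mu> z)"

definition h_contraction :: "'n::finite d_connection \<Rightarrow> 'n \<Rightarrow> 'n \<Rightarrow> 'n lfun" where
  "h_contraction D \<sigma> \<nu> z = (\<Sum>\<alpha>\<in>UNIV. h_curvature D \<alpha> \<alpha> \<sigma> \<nu> z)"

definition v_contraction :: "'n::finite d_connection \<Rightarrow> 'n \<Rightarrow> 'n \<Rightarrow> 'n lfun" where
  "v_contraction D \<sigma> \<nu> z = (\<Sum>\<alpha>\<in>UNIV. v_curvature D \<alpha> \<alpha> \<sigma> \<nu> z)"

definition h_torsion :: "'n::finite d_connection \<Rightarrow> 'n \<Rightarrow> 'n \<Rightarrow> 'n \<Rightarrow> 'n lfun" where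
  "h_torsion D \<alpha> \<mu> \<nu> z = Hco D \<alpha> \<mu> \<nu> z - Hco D \<alpha> \<nu> \<mu> z"

definition v_torsion :: "'n::finite d_connection \<Rightarrow> 'n \<Rightarrow> 'n \<Rightarrow> 'n \<Rightarrow> 'n lfun" where
  "v_torsion D \<alpha> \<mu> \<nu> z = Vco D \<alpha> \<mu> \<nu> z - Vco D \<alpha> \<nu> \<mu> z"

definition h_torsion_trace :: "'n::finite d_connection \<Rightarrow> 'n \<Rightarrow> 'n lfun" where
  "h_torsion_trace D \<mu> z = (\<Sum>\<epsilon>\<in>UNIV. h_torsion D \<epsilon> \<mu> \<epsilon> z)"

definition v_torsion_trace :: "'n::finite d_connection \<Rightarrow> 'n \<Rightarrow> 'n lfun" where
  "v_torsion_trace D \<mu> z = (\<Sum>\<epsilon>\<in>UNIV. v_torsion D \<epsilon> \<mu> \<epsilon> z)"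

end

theory Submission
  imports Defs
begin

text \<open>In the trace of a curvature tensor over its first two indices the terms quadratic in the
  coefficients cancel, so the contraction only depends on the traces of \<open>\<Gamma>\<close> and \<open>C\<close> over their first
  two indices: it is \<open>\<delta>\<^sub>\<nu> tr \<Gamma>\<^sub>\<sigma> - \<delta>\<^sub>\<sigma> tr \<Gamma>\<^sub>\<nu> + tr C\<^sub>\<epsilon> R\<^sup>\<epsilon>\<^sub>\<sigma>\<^sub>\<nu>\<close>, and similarly vertically. For the canonical
  connection the traces are the logarithmic derivatives of \<open>det (\<lambda>\<^sub>(\<^sub>i\<^sub>)\<^sub>\<alpha>)\<close>, so the contraction vanishes
  by the commutator identity \<open>[\<delta>\<^sub>\<nu>, \<delta>\<^sub>\<sigma>] = - R\<^sup>\<epsilon>\<^sub>\<sigma>\<^sub>\<nu> d/dy\<^sup>\<epsilon>\<close>. The Riemannian connection has the same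
  traces; those of the dual and symmetric connections differ from them by \<open>\<beta>\<close>, \<open>B\<close> and by \<open>\<beta>/2\<close>,
  \<open>B/2\<close>.\<close>

section \<open>Calculus of smooth functions\<close>

lemma Ck_on_subset: "Ck_on k S f \<Longrightarrow> T \<subseteq> S \<Longrightarrow> Ck_on k T f"
  by (induction k arbitrary: f) (auto intro: continuous_on_subset)

text \<open>As \<open>S\<close> is open, derivatives at its points see only values on
  \<open>S\<close>. A differentiation rule valid just on \<open>S\<close> can therefore be
  substituted inside \<open>Ck_on\<close>, which is how the inductions below proceed.\<close>

lemma Ck_on_cong:
  assumes "open S" "\<And>x. x \<in> S \<Longrightarrow> f x = g x" "Ck_on k S f"
  shows "Ck_on k S g"
  using assms(2,3)
proof (induction k arbitrary: f g)
  case 0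
  then show ?case
    by (metis Ck_on.simps(1) continuous_on_cong)
next
  case (Suc k)
  have eq: "frechet_derivative f (at x) = frechet_derivative g (at x)" if "x \<in> S" for x
    using frechet_derivative_transform_within_open[of f x S g] that assms(1) Suc.prems by simp
  have "g differentiable at x" if "x \<in> S" for x
    using Suc.prems that assms(1) has_derivative_transform_within_open[of f _ x UNIV S g]
    unfolding differentiable_def by (metis Ck_on.simps(2) differentiable_def)
  moreover have "Ck_on k S (\<lambda>x. frechet_derivative g (at x) v)" for v
    by (rule Suc.IH[of "\<lambda>x. frechet_derivative f (at x) v"]) (use eq Suc.prems in auto)
  ultimately show ?case by simp
qed

text \<open>Needed where a derivative formula still contains the undifferentiated function, as the
  product rule does: that factor has to be lowered by one order.\<close>

lemma Ck_on_Suc_D: "Ck_on (Suc k) S f \<Longrightarrow> Ck_on k S f"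
proof (induction k arbitrary: f)
  case 0
  then show ?case
    by (auto intro!: continuous_at_imp_continuous_on differentiable_imp_continuous_within)
next
  case (Suc k)
  then show ?case by (metis Ck_on.simps(2))
qed

lemma Ck_on_const: "Ck_on k S (\<lambda>x. c)"
  by (induction k arbitrary: c) auto

lemma frechet_derivative_plus_at:
  assumes "f differentiable at x" "g differentiable at x"
  shows "frechet_derivative (\<lambda>x. f x + g x) (at x) v
    = frechet_derivative f (at x) v + frechet_derivative g (at x) v"
proof -
  have "((\<lambda>x. f x + g x) has_derivative
      (\<lambda>h. frechet_derivative f (at x) h + frechet_derivative g (at x) h)) (at x)"
    using assms by (intro has_derivative_add) (simp_all add: frechet_derivative_works)
  from frechet_derivative_at[OF this, symmetric] show ?thesis by simp
qed

lemma frechet_derivative_mult_at: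
  fixes f g :: "'v::real_normed_vector \<Rightarrow> real"
  assumes "f differentiable at x" "g differentiable at x"
  shows "frechet_derivative (\<lambda>x. f x * g x) (at x) v
    = frechet_derivative f (at x) v * g x + f x * frechet_derivative g (at x) v"
proof -
  have "((\<lambda>x. f x * g x) has_derivative
      (\<lambda>h. f x * frechet_derivative g (at x) h + frechet_derivative f (at x) h * g x)) (at x)"
    using assms by (intro has_derivative_mult) (simp_all add: frechet_derivative_works)
  from frechet_derivative_at[OF this, symmetric] show ?thesis by simp
qed

lemma frechet_derivative_inverse_at:
  fixes f :: "'v::real_normed_vector \<Rightarrow> real"
  assumes "f differentiable at x" "f x \<noteq> 0"
  shows "frechet_derivative (\<lambda>x. inverse (f x)) (at x) v
    = - frechet_derivative f (at x) v * (inverse (f x) * inverse (f x))"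
proof -
  have "((\<lambda>x. inverse (f x)) has_derivative
      (\<lambda>h. - (inverse (f x) * frechet_derivative f (at x) h * inverse (f x)))) (at x)"
    using assms by (intro Deriv.has_derivative_inverse) (simp_all add: frechet_derivative_works)
  from frechet_derivative_at[OF this, symmetric] show ?thesis by simp
qed

lemma Ck_on_add:
  fixes f g :: "'v::real_normed_vector \<Rightarrow> 'w::real_normed_vector"
  assumes "open S" "Ck_on k S f" "Ck_on k S g"
  shows "Ck_on k S (\<lambda>x. f x + g x)"
  using assms(2,3)
proof (induction k arbitrary: f g)
  case 0
  then show ?case by (simp add: continuous_on_add)
next
  case (Suc k)
  have "Ck_on k S (\<lambda>x. frechet_derivative (\<lambda>x. f x + g x) (at x) v)" for v
    by (rule Ck_on_cong[OF assms(1) _ Suc.IH[of "\<lambda>x. frechet_derivative f (at x) v" "\<lambda>x. frechet_derivative g (at x) v"]])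
      (use Suc.prems in \<open>auto simp: frechet_derivative_plus_at\<close>)
  then show ?case using Suc.prems by auto
qed

lemma Ck_on_mult:
  fixes f g :: "'v::real_normed_vector \<Rightarrow> real"
  assumes "open S" "Ck_on k S f" "Ck_on k S g"
  shows "Ck_on k S (\<lambda>x. f x * g x)"
  using assms(2,3)
proof (induction k arbitrary: f g)
  case 0
  then show ?case by (simp add: continuous_on_mult)
next
  case (Suc k)
  have "Ck_on k S (\<lambda>x. frechet_derivative f (at x) v * g x + f x * frechet_derivative g (at x) v)" for v
    using Suc.prems by (intro Ck_on_add assms(1) Suc.IH) (auto intro: Ck_on_Suc_D simp del: Ck_on.simps simp: Ck_on.simps(2))
  then have "Ck_on k S (\<lambda>x. frechet_derivative (\<lambda>x. f x * g x) (at x) v)" for v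
    by (rule Ck_on_cong[OF assms(1), rotated]) (use Suc.prems in \<open>auto simp: frechet_derivative_mult_at\<close>)
  then show ?case using Suc.prems by auto
qed

text \<open>The derivative of the reciprocal contains \<open>inverse (f x)\<close> again, now at
  order \<open>k\<close>. The induction therefore keeps \<open>f\<close> fixed, and its hypothesis
  supplies this factor.\<close>

lemma Ck_on_inverse:
  fixes f :: "'v::real_normed_vector \<Rightarrow> real"
  assumes "open S" "Ck_on k S f" "\<And>x. x \<in> S \<Longrightarrow> f x \<noteq> 0"
  shows "Ck_on k S (\<lambda>x. inverse (f x))"
  using assms(2)
proof (induction k)
  case 0
  then show ?case using assms(3) by (simp add: continuous_on_inverse)
next
  case (Suc k)
  have "Ck_on k S (\<lambda>x. inverse (f x))"
    using Suc Ck_on_Suc_D by blast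
  moreover have "Ck_on k S (\<lambda>x. - 1 * frechet_derivative f (at x) v)" for v
    using Suc.prems by (intro Ck_on_mult assms(1) Ck_on_const) auto
  ultimately have "Ck_on k S (\<lambda>x. - 1 * frechet_derivative f (at x) v * (inverse (f x) * inverse (f x)))" for v
    using Ck_on_mult[OF assms(1)] by metis
  then have "Ck_on k S (\<lambda>x. frechet_derivative (\<lambda>x. inverse (f x)) (at x) v)" for v
    by (rule Ck_on_cong[OF assms(1), rotated]) (use Suc.prems assms(3) in \<open>auto simp: frechet_derivative_inverse_at\<close>)
  then show ?case using Suc.prems assms(3) by auto
qed

section \<open>Closure properties of smooth functions\<close>

lemma smooth_on_subset: "smooth_on S f \<Longrightarrow> T \<subseteq> S \<Longrightarrow> smooth_on T f"
  using Ck_on_subset unfolding smooth_on_def by blast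

lemma smooth_on_cong: "smooth_on S f \<Longrightarrow> open S \<Longrightarrow> (\<And>x. x \<in> S \<Longrightarrow> f x = g x) \<Longrightarrow> smooth_on S g"
  using Ck_on_cong unfolding smooth_on_def by blast

lemma smooth_on_const: "smooth_on S (\<lambda>x. c)"
  by (simp add: smooth_on_def Ck_on_const)

lemma smooth_on_add:
  fixes f g :: "'v::real_normed_vector \<Rightarrow> 'w::real_normed_vector"
  shows "open S \<Longrightarrow> smooth_on S f \<Longrightarrow> smooth_on S g \<Longrightarrow> smooth_on S (\<lambda>x. f x + g x)"
  by (simp add: smooth_on_def Ck_on_add)

lemma smooth_on_mult:
  fixes f g :: "'v::real_normed_vector \<Rightarrow> real"
  shows "open S \<Longrightarrow> smooth_on S f \<Longrightarrow> smooth_on S g \<Longrightarrow> smooth_on S (\<lambda>x. f x * g x)"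
  by (simp add: smooth_on_def Ck_on_mult)

lemma smooth_on_inverse:
  fixes f :: "'v::real_normed_vector \<Rightarrow> real"
  shows "open S \<Longrightarrow> smooth_on S f \<Longrightarrow> (\<And>x. x \<in> S \<Longrightarrow> f x \<noteq> 0) \<Longrightarrow> smooth_on S (\<lambda>x. inverse (f x))"
  by (simp add: smooth_on_def Ck_on_inverse)

lemma smooth_on_uminus:
  fixes f :: "'v::real_normed_vector \<Rightarrow> real"
  shows "open S \<Longrightarrow> smooth_on S f \<Longrightarrow> smooth_on S (\<lambda>x. - f x)"
  using smooth_on_mult[of S "\<lambda>x. - 1" f] by (simp add: smooth_on_const)

lemma smooth_on_diff:
  fixes f g :: "'v::real_normed_vector \<Rightarrow> real"
  shows "open S \<Longrightarrow> smooth_on S f \<Longrightarrow> smooth_on S g \<Longrightarrow> smooth_on S (\<lambda>x. f x - g x)"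
  using smooth_on_add[of S f "\<lambda>x. - g x"] by (simp add: smooth_on_uminus)

lemma smooth_on_sum:
  fixes f :: "'i \<Rightarrow> 'v::real_normed_vector \<Rightarrow> 'w::real_normed_vector"
  assumes "open S" "\<And>i. i \<in> I \<Longrightarrow> smooth_on S (f i)"
  shows "smooth_on S (\<lambda>x. \<Sum>i\<in>I. f i x)"
  using assms(2)
  by (induction I rule: infinite_finite_induct) (auto intro!: smooth_on_const smooth_on_add assms(1))

lemma smooth_on_prod:
  fixes f :: "'i \<Rightarrow> 'v::real_normed_vector \<Rightarrow> real"
  assumes "open S" "\<And>i. i \<in> I \<Longrightarrow> smooth_on S (f i)"
  shows "smooth_on S (\<lambda>x. \<Prod>i\<in>I. f i x)"
  using assms(2)
  by (induction I rule: infinite_finite_induct) (auto intro!: smooth_on_const smooth_on_mult assms(1))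

text \<open>By the Leibniz formula the determinant is a polynomial in the entries. This serves both
  Cramer's rule for the coframe and the openness of the set where the frame is
  nondegenerate.\<close>

lemma smooth_on_det:
  fixes F :: "'n::finite \<Rightarrow> 'n \<Rightarrow> 'v::real_normed_vector \<Rightarrow> real"
  assumes "open S" "\<And>i j. smooth_on S (F i j)"
  shows "smooth_on S (\<lambda>z. det (\<chi> i j. F i j z))"
  unfolding det_def by (simp, intro smooth_on_sum smooth_on_mult smooth_on_prod smooth_on_const assms)

lemma smooth_on_imp_continuous_on: "smooth_on S f \<Longrightarrow> continuous_on S f"
  unfolding smooth_on_def using Ck_on.simps(1) by blast

lemma smooth_on_differentiable: "smooth_on S f \<Longrightarrow> x \<in> S \<Longrightarrow> f differentiable at x"
  unfolding smooth_on_def using Ck_on.simps(2) by blast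

lemma smooth_on_frechet_derivative: "smooth_on S f \<Longrightarrow> smooth_on S (\<lambda>x. frechet_derivative f (at x) v)"
  unfolding smooth_on_def using Ck_on.simps(2) by blast

section \<open>Symmetry of second derivatives\<close>

lemma has_real_derivative_along_line:
  fixes f :: "'v::real_normed_vector \<Rightarrow> real"
  assumes "f differentiable at (p + s *\<^sub>R v)"
  shows "((\<lambda>s. f (p + s *\<^sub>R v)) has_real_derivative frechet_derivative f (at (p + s *\<^sub>R v)) v) (at s)"
proof -
  let ?D = "frechet_derivative f (at (p + s *\<^sub>R v))"
  have f: "(f has_derivative ?D) (at (p + s *\<^sub>R v))"
    using assms by (simp add: frechet_derivative_works)
  have "((\<lambda>s. p + s *\<^sub>R v) has_derivative (\<lambda>h. h *\<^sub>R v)) (at s)"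
    by (auto intro!: derivative_eq_intros)
  then have "((\<lambda>s. f (p + s *\<^sub>R v)) has_derivative (\<lambda>h. ?D (h *\<^sub>R v))) (at s)"
    using f has_derivative_compose by blast
  moreover have "?D (h *\<^sub>R v) = ?D v * h" for h
    using linear_frechet_derivative[OF assms] by (simp add: linear_scale)
  ultimately show ?thesis by (simp add: has_field_derivative_def)
qed

text \<open>Two applications of the mean value theorem: in direction \<open>v\<close> to the
  difference of \<open>f\<close> along two parallel segments, then in direction \<open>w\<close> to
  the directional derivative so obtained.\<close>

lemma second_difference_mean_value:
  fixes f :: "'v::real_normed_vector \<Rightarrow> real"
  assumes f: "smooth_on S f" and "0 < t"
    and in_S: "\<And>a b. 0 \<le> a \<Longrightarrow> a \<le> t \<Longrightarrow> 0 \<le> b \<Longrightarrow> b \<le> t \<Longrightarrow> z + a *\<^sub>R v + b *\<^sub>R w \<in> S"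
  obtains a b where "0 \<le> a" "a \<le> t" "0 \<le> b" "b \<le> t"
    "f (z + t *\<^sub>R v + t *\<^sub>R w) - f (z + t *\<^sub>R v) - f (z + t *\<^sub>R w) + f z
      = t * (t * frechet_derivative (\<lambda>x. frechet_derivative f (at x) v) (at (z + a *\<^sub>R v + b *\<^sub>R w)) w)"
proof -
  let ?D = "\<lambda>x. frechet_derivative f (at x) v"
  let ?g = "\<lambda>s. f ((z + t *\<^sub>R w) + s *\<^sub>R v) - f (z + s *\<^sub>R v)"
  have in_S': "(z + t *\<^sub>R w) + s *\<^sub>R v \<in> S" "z + s *\<^sub>R v \<in> S" if "0 \<le> s" "s \<le> t" for s
    using in_S[of s t] in_S[of s 0] that \<open>0 < t\<close> by (simp_all add: algebra_simps)
  have "\<exists>a>0. a < t \<and> ?g t - ?g 0 = (t - 0) * (?D ((z + t *\<^sub>R w) + a *\<^sub>R v) - ?D (z + a *\<^sub>R v))"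
    using \<open>0 < t\<close>
    by (intro MVT2 DERIV_diff has_real_derivative_along_line smooth_on_differentiable[OF f] in_S') auto
  then obtain a where a: "0 < a" "a < t"
    "?g t - ?g 0 = t * (?D ((z + t *\<^sub>R w) + a *\<^sub>R v) - ?D (z + a *\<^sub>R v))" by auto
  let ?h = "\<lambda>s. ?D ((z + a *\<^sub>R v) + s *\<^sub>R w)"
  have "\<exists>b>0. b < t \<and> ?h t - ?h 0 = (t - 0) * frechet_derivative ?D (at ((z + a *\<^sub>R v) + b *\<^sub>R w)) w"
    using \<open>0 < t\<close> a in_S
    by (intro MVT2 has_real_derivative_along_line smooth_on_differentiable[OF smooth_on_frechet_derivative[OF f]]) auto
  then obtain b where b: "0 < b" "b < t"
    "?h t - ?h 0 = t * frechet_derivative ?D (at ((z + a *\<^sub>R v) + b *\<^sub>R w)) w" by auto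
  have "?h t - ?h 0 = ?D ((z + t *\<^sub>R w) + a *\<^sub>R v) - ?D (z + a *\<^sub>R v)"
    by (simp add: algebra_simps)
  moreover have "?g t - ?g 0 = f (z + t *\<^sub>R v + t *\<^sub>R w) - f (z + t *\<^sub>R v) - f (z + t *\<^sub>R w) + f z"
    by (simp add: algebra_simps)
  ultimately show ?thesis
    using that[of a b] a b by auto
qed

text \<open>Schwarz's theorem: both mixed derivatives are limits of the same second difference quotient.\<close>

lemma smooth_on_mixed_derivatives_commute:
  fixes f :: "'v::real_normed_vector \<Rightarrow> real"
  assumes f: "smooth_on S f" and "open S" "z \<in> S"
  shows "frechet_derivative (\<lambda>x. frechet_derivative f (at x) v) (at z) w
    = frechet_derivative (\<lambda>x. frechet_derivative f (at x) w) (at z) v"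
proof (rule ccontr)
  define P where "P v w x = frechet_derivative (\<lambda>x. frechet_derivative f (at x) v) (at x) w" for v w x
  assume "\<not> ?thesis"
  then have "P v w z \<noteq> P w v z" by (simp add: P_def)
  \<comment> \<open>Half the assumed gap: values of the two mixed derivatives within
    \<open>e\<close> of their values at \<open>z\<close> cannot coincide.\<close>
  define e where "e = \<bar>P v w z - P w v z\<bar> / 2"
  have "e > 0" using \<open>P v w z \<noteq> P w v z\<close> by (simp add: e_def)
  have "isCont (P v w) z" for v w
    unfolding P_def using assms smooth_on_frechet_derivative smooth_on_imp_continuous_on continuous_on_eq_continuous_at
    by blast
  then have lim: "(P v w \<longlongrightarrow> P v w z) (nhds z)" for v w
    by (simp only: isCont_def tendsto_at_iff_tendsto_nhds)
  then have near: "\<forall>\<^sub>F x in nhds z. \<bar>P v w x - P v w z\<bar> < e" for v w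
    using tendstoD[OF lim[of v w] \<open>e > 0\<close>] by (simp only: dist_real_def)
  have "\<forall>\<^sub>F x in nhds z. x \<in> S \<and> \<bar>P v w x - P v w z\<bar> < e \<and> \<bar>P w v x - P w v z\<bar> < e"
    using near[of v w] near[of w v] eventually_nhds_in_open[OF \<open>open S\<close> \<open>z \<in> S\<close>]
    by eventually_elim auto
  then obtain d where "d > 0"
    and d: "\<And>x. dist x z < d \<Longrightarrow> x \<in> S \<and> \<bar>P v w x - P v w z\<bar> < e \<and> \<bar>P w v x - P w v z\<bar> < e"
    unfolding eventually_nhds_metric by blast
  \<comment> \<open>This puts the parallelogram spanned at \<open>z\<close> by
    \<open>t *\<^sub>R v\<close> and \<open>t *\<^sub>R w\<close> inside the ball of radius
    \<open>d\<close>. The summand \<open>1\<close> keeps the denominator positive for zero vectors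
    and makes the estimate strict.\<close>
  define t where "t = d / (norm v + norm w + 1)"
  have pos: "norm v + norm w + 1 > 0" by (smt (verit) norm_ge_zero)
  then have "t > 0" using \<open>d > 0\<close> by (simp add: t_def)
  have small: "dist (z + a *\<^sub>R v + b *\<^sub>R w) z < d" if "0 \<le> a" "a \<le> t" "0 \<le> b" "b \<le> t" for a b
  proof -
    have "dist (z + a *\<^sub>R v + b *\<^sub>R w) z = norm (a *\<^sub>R v + b *\<^sub>R w)"
      by (simp add: dist_norm algebra_simps)
    also have "\<dots> \<le> a * norm v + b * norm w"
      using norm_triangle_ineq[of "a *\<^sub>R v" "b *\<^sub>R w"] that by simp
    also have "\<dots> \<le> t * norm v + t * norm w"
      using that by (intro add_mono mult_right_mono) auto
    also have "\<dots> < t * (norm v + norm w + 1)"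
      using \<open>t > 0\<close> by (simp add: algebra_simps)
    also have "\<dots> = d" using pos by (simp add: t_def)
    finally show ?thesis .
  qed
  have small': "dist (z + a *\<^sub>R w + b *\<^sub>R v) z < d" if "0 \<le> a" "a \<le> t" "0 \<le> b" "b \<le> t" for a b
    using small[of b a] that by (simp add: algebra_simps)
  obtain a b where ab: "0 \<le> a" "a \<le> t" "0 \<le> b" "b \<le> t"
    "f (z + t *\<^sub>R v + t *\<^sub>R w) - f (z + t *\<^sub>R v) - f (z + t *\<^sub>R w) + f z = t * (t * P v w (z + a *\<^sub>R v + b *\<^sub>R w))"
    by (rule second_difference_mean_value[OF f \<open>t > 0\<close>, of z v w, folded P_def]) (use small d in blast)+
  obtain a' b' where ab': "0 \<le> a'" "a' \<le> t" "0 \<le> b'" "b' \<le> t"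
    "f (z + t *\<^sub>R w + t *\<^sub>R v) - f (z + t *\<^sub>R w) - f (z + t *\<^sub>R v) + f z = t * (t * P w v (z + a' *\<^sub>R w + b' *\<^sub>R v))"
    by (rule second_difference_mean_value[OF f \<open>t > 0\<close>, of z w v, folded P_def]) (use small' d in blast)+
  \<comment> \<open>Both sides are the same second difference, which is symmetric in
    \<open>v\<close> and \<open>w\<close>. Cancelling \<open>t\<close> twice equates the two mixed
    derivatives at two points of the ball.\<close>
  have "t * (t * P v w (z + a *\<^sub>R v + b *\<^sub>R w)) = t * (t * P w v (z + a' *\<^sub>R w + b' *\<^sub>R v))"
    unfolding ab(5)[symmetric] ab'(5)[symmetric] by (simp add: algebra_simps)
  then have "P v w (z + a *\<^sub>R v + b *\<^sub>R w) = P w v (z + a' *\<^sub>R w + b' *\<^sub>R v)"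
    using \<open>t > 0\<close> by simp
  then show False
    using d[OF small[OF ab(1-4)]] d[OF small'[OF ab'(1-4)]] unfolding e_def by (auto simp: abs_if split: if_splits)
qed

section \<open>Derivations and the curl of a trace\<close>

text \<open>What \<open>delta N \<mu>\<close> and \<open>d_y \<mu>\<close> have in common, so that
  the trace computations serve the horizontal and the vertical case at once. Locality is an axiom
  because relations such as the duality of frame and coframe are available on \<open>S\<close>
  only.\<close>

locale derivation =
  fixes S :: "'v::real_normed_vector set" and d :: "('v \<Rightarrow> real) \<Rightarrow> 'v \<Rightarrow> real"
  assumes open_S: "open S"
    and local: "smooth_on S f \<Longrightarrow> (\<And>x. x \<in> S \<Longrightarrow> f x = g x) \<Longrightarrow> z \<in> S \<Longrightarrow> d f z = d g z"
    and const: "z \<in> S \<Longrightarrow> d (\<lambda>x. r) z = 0"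
    and add: "smooth_on S f \<Longrightarrow> smooth_on S g \<Longrightarrow> z \<in> S \<Longrightarrow> d (\<lambda>x. f x + g x) z = d f z + d g z"
    and mult: "smooth_on S f \<Longrightarrow> smooth_on S g \<Longrightarrow> z \<in> S \<Longrightarrow>
      d (\<lambda>x. f x * g x) z = d f z * g z + f z * d g z"
    and smooth: "smooth_on S f \<Longrightarrow> smooth_on S (d f)"
begin

lemma cmult: "smooth_on S f \<Longrightarrow> z \<in> S \<Longrightarrow> d (\<lambda>x. r * f x) z = r * d f z"
  using mult[of "\<lambda>x. r" f z] by (simp add: const smooth_on_const)

lemma diff:
  assumes "smooth_on S f" "smooth_on S g" "z \<in> S"
  shows "d (\<lambda>x. f x - g x) z = d f z - d g z"
  using add[of f "\<lambda>x. - 1 * g x" z] cmult[of g z "- 1"] assms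
  by (simp add: smooth_on_uminus open_S)

lemma sum:
  assumes "\<And>i. i \<in> I \<Longrightarrow> smooth_on S (f i)" "z \<in> S"
  shows "d (\<lambda>x. \<Sum>i\<in>I. f i x) z = (\<Sum>i\<in>I. d (f i) z)"
  using assms(1)
proof (induction I rule: infinite_finite_induct)
  case (insert i I)
  then show ?case
    using add[of "f i" "\<lambda>x. \<Sum>i\<in>I. f i x" z] assms(2) by (simp add: smooth_on_sum open_S)
qed (simp_all add: const assms(2))

end

lemma derivation_frechet_derivative:
  assumes "open S"
  shows "derivation S (\<lambda>f z. frechet_derivative f (at z) v)"
proof
  fix f g :: "'a \<Rightarrow> real" and z
  assume "smooth_on S f" "\<And>x. x \<in> S \<Longrightarrow> f x = g x" "z \<in> S"
  then show "frechet_derivative f (at z) v = frechet_derivative g (at z) v"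
    using frechet_derivative_transform_within_open[of f z S g] assms smooth_on_differentiable by metis
qed (use assms in \<open>simp_all add: frechet_derivative_plus_at frechet_derivative_mult_at
      smooth_on_differentiable smooth_on_frechet_derivative\<close>)

lemma derivation_d_x: "open S \<Longrightarrow> derivation S (d_x \<mu>)"
  using derivation_frechet_derivative[of S "(axis \<mu> 1, 0)"] by (simp add: d_x_def[abs_def])

lemma derivation_d_y: "open S \<Longrightarrow> derivation S (d_y \<mu>)"
  using derivation_frechet_derivative[of S "(0, axis \<mu> 1)"] by (simp add: d_y_def[abs_def])

text \<open>A combination of derivations with function coefficients is a derivation; smoothness of
  \<open>N\<close> is what keeps \<open>delta N \<mu> f\<close> smooth.\<close>

lemma derivation_delta:
  fixes N :: "'n \<Rightarrow> 'n \<Rightarrow> 'n::finite lfun"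
  assumes "open S" and N: "\<And>\<alpha> \<mu>. smooth_on S (N \<alpha> \<mu>)"
  shows "derivation S (delta N \<mu>)"
proof
  interpret x: derivation S "d_x \<mu>" by (rule derivation_d_x[OF assms(1)])
  interpret y: derivation S "d_y \<alpha>" for \<alpha> by (rule derivation_d_y[OF assms(1)])
  fix f g :: "'n lfun" and z and r :: real
  show "open S" by fact
  show "smooth_on S (delta N \<mu> f)" if "smooth_on S f"
    unfolding delta_def[abs_def]
    by (intro smooth_on_diff smooth_on_sum smooth_on_mult x.smooth y.smooth N that \<open>open S\<close>)
  assume z: "z \<in> S"
  show "delta N \<mu> (\<lambda>x. r) z = 0"
    by (simp add: delta_def x.const y.const z)
  assume f: "smooth_on S f"
  show "delta N \<mu> f z = delta N \<mu> g z" if "\<And>x. x \<in> S \<Longrightarrow> f x = g x"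
    using x.local[OF f that z] y.local[OF f that z] by (simp add: delta_def)
  assume g: "smooth_on S g"
  show "delta N \<mu> (\<lambda>x. f x + g x) z = delta N \<mu> f z + delta N \<mu> g z"
    by (simp add: delta_def x.add y.add f g z algebra_simps sum.distrib)
  show "delta N \<mu> (\<lambda>x. f x * g x) z = delta N \<mu> f z * g z + f z * delta N \<mu> g z"
    by (simp add: delta_def x.mult y.mult f g z algebra_simps sum.distrib sum_distrib_left)
qed

section \<open>Commutators of the coordinate derivatives and of \<open>delta\<close>\<close>

lemma d_y_commute:
  "open S \<Longrightarrow> smooth_on S f \<Longrightarrow> z \<in> S \<Longrightarrow> d_y \<mu> (d_y \<nu> f) z = d_y \<nu> (d_y \<mu> f) z"
  unfolding d_y_def[abs_def] by (rule smooth_on_mixed_derivatives_commute)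

lemma d_x_commute:
  "open S \<Longrightarrow> smooth_on S f \<Longrightarrow> z \<in> S \<Longrightarrow> d_x \<mu> (d_x \<nu> f) z = d_x \<nu> (d_x \<mu> f) z"
  unfolding d_x_def[abs_def] by (rule smooth_on_mixed_derivatives_commute)

lemma d_x_d_y_commute:
  "open S \<Longrightarrow> smooth_on S f \<Longrightarrow> z \<in> S \<Longrightarrow> d_x \<mu> (d_y \<nu> f) z = d_y \<nu> (d_x \<mu> f) z"
  unfolding d_x_def[abs_def] d_y_def[abs_def] by (rule smooth_on_mixed_derivatives_commute)

text \<open>The second-order terms cancel by symmetry of mixed derivatives. What remains is the
  antisymmetrised \<open>delta\<close> of the coefficients of \<open>N\<close>; the minus sign comes
  from the one in front of \<open>N\<close> in \<open>delta\<close>.\<close>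

lemma delta_commutator:
  fixes N :: "'n \<Rightarrow> 'n \<Rightarrow> 'n::finite lfun"
  assumes S: "open S" and N: "\<And>\<alpha> \<mu>. smooth_on S (N \<alpha> \<mu>)" and f: "smooth_on S f" and z: "z \<in> S"
  shows "delta N \<nu> (delta N \<sigma> f) z - delta N \<sigma> (delta N \<nu> f) z
    = - (\<Sum>\<epsilon>\<in>UNIV. N_curvature N \<epsilon> \<sigma> \<nu> z * d_y \<epsilon> f z)"
proof -
  interpret x: derivation S "d_x \<mu>" for \<mu> by (rule derivation_d_x[OF S])
  interpret y: derivation S "d_y \<mu>" for \<mu> by (rule derivation_d_y[OF S])
  interpret h: derivation S "delta N \<mu>" for \<mu> by (rule derivation_delta[OF S N])
  note smooth = x.smooth y.smooth h.smooth N f S smooth_on_mult smooth_on_sum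
  \<comment> \<open>The derivative of \<open>N\<close> is left in the form that occurs in
    \<open>N_curvature\<close>. Exchanging \<nu> and \<sigma> interchanges the first and third
    single sums, up to the order of differentiation.\<close>
  have expand: "delta N \<nu> (delta N \<sigma> f) z =
      d_x \<nu> (d_x \<sigma> f) z - (\<Sum>\<beta>\<in>UNIV. N \<beta> \<nu> z * d_y \<beta> (d_x \<sigma> f) z)
      - (\<Sum>\<epsilon>\<in>UNIV. delta N \<nu> (N \<epsilon> \<sigma>) z * d_y \<epsilon> f z)
      - (\<Sum>\<epsilon>\<in>UNIV. N \<epsilon> \<sigma> z * d_x \<nu> (d_y \<epsilon> f) z)
      + (\<Sum>\<epsilon>\<in>UNIV. \<Sum>\<beta>\<in>UNIV. N \<epsilon> \<sigma> z * N \<beta> \<nu> z * d_y \<beta> (d_y \<epsilon> f) z)" for \<nu> \<sigma>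
  proof -
    have "delta N \<nu> (delta N \<sigma> f) z = delta N \<nu> (d_x \<sigma> f) z
        - delta N \<nu> (\<lambda>z. \<Sum>\<epsilon>\<in>UNIV. N \<epsilon> \<sigma> z * d_y \<epsilon> f z) z"
      unfolding delta_def[of N \<sigma> f, abs_def] by (intro h.diff z smooth)
    also have "delta N \<nu> (\<lambda>z. \<Sum>\<epsilon>\<in>UNIV. N \<epsilon> \<sigma> z * d_y \<epsilon> f z) z
        = (\<Sum>\<epsilon>\<in>UNIV. delta N \<nu> (\<lambda>z. N \<epsilon> \<sigma> z * d_y \<epsilon> f z) z)"
      by (intro h.sum z smooth)
    also have "\<dots> = (\<Sum>\<epsilon>\<in>UNIV. delta N \<nu> (N \<epsilon> \<sigma>) z * d_y \<epsilon> f z + N \<epsilon> \<sigma> z * delta N \<nu> (d_y \<epsilon> f) z)"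
      by (intro sum.cong refl h.mult z smooth)
    finally show ?thesis
      by (simp add: delta_def[of N \<nu> "d_y _ f"] delta_def[of N \<nu> "d_x _ f"]
          algebra_simps sum.distrib sum_subtractf sum_distrib_left)
  qed
  have "(\<Sum>\<epsilon>\<in>UNIV. \<Sum>\<beta>\<in>UNIV. N \<epsilon> \<sigma> z * N \<beta> \<nu> z * d_y \<beta> (d_y \<epsilon> f) z)
      = (\<Sum>\<epsilon>\<in>UNIV. \<Sum>\<beta>\<in>UNIV. N \<epsilon> \<nu> z * N \<beta> \<sigma> z * d_y \<beta> (d_y \<epsilon> f) z)"
    by (subst sum.swap) (intro sum.cong refl, simp add: d_y_commute[OF S f z] mult.commute)
  then show ?thesis
    unfolding expand[of \<nu> \<sigma>] expand[of \<sigma> \<nu>]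
    by (simp add: N_curvature_def d_x_commute[OF S f z, of \<nu>] d_x_d_y_commute[OF S f z]
        sum_subtractf left_diff_distrib)
qed

text \<open>The terms quadratic in first derivatives cancel, because \<open>dL = - L (dK) L\<close> makes
  \<open>tr (d\<^sub>\<nu>L d\<^sub>\<sigma>K)\<close> symmetric in \<open>\<nu>\<close> and \<open>\<sigma>\<close>.\<close>

lemma curl_trace_inverse_derivative:
  fixes L K :: "'n::finite \<Rightarrow> 'n \<Rightarrow> 'v::real_normed_vector \<Rightarrow> real"
  assumes d: "\<And>\<nu>. derivation S (d \<nu>)"
    and L: "\<And>i \<alpha>. smooth_on S (L i \<alpha>)" and K: "\<And>i \<alpha>. smooth_on S (K i \<alpha>)"
    and dual: "\<And>i j z. z \<in> S \<Longrightarrow> (\<Sum>\<beta>\<in>UNIV. L i \<beta> z * K j \<beta> z) = (if i = j then 1 else 0)"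
    and dual': "\<And>\<alpha> \<beta> z. z \<in> S \<Longrightarrow> (\<Sum>i\<in>UNIV. K i \<alpha> z * L i \<beta> z) = (if \<alpha> = \<beta> then 1 else 0)"
    and z: "z \<in> S"
  shows "d \<nu> (\<lambda>z. \<Sum>\<alpha>\<in>UNIV. \<Sum>i\<in>UNIV. L i \<alpha> z * d \<sigma> (K i \<alpha>) z) z
      - d \<sigma> (\<lambda>z. \<Sum>\<alpha>\<in>UNIV. \<Sum>i\<in>UNIV. L i \<alpha> z * d \<nu> (K i \<alpha>) z) z
    = (\<Sum>\<alpha>\<in>UNIV. \<Sum>i\<in>UNIV. L i \<alpha> z * (d \<nu> (d \<sigma> (K i \<alpha>)) z - d \<sigma> (d \<nu> (K i \<alpha>)) z))"
proof -
  interpret derivation S "d \<mu>" for \<mu> by (rule d)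
  note smooths = smooth L K open_S smooth_on_mult smooth_on_sum
  have expand: "d \<nu> (\<lambda>z. \<Sum>\<alpha>\<in>UNIV. \<Sum>i\<in>UNIV. L i \<alpha> z * d \<sigma> (K i \<alpha>) z) z
      = (\<Sum>\<alpha>\<in>UNIV. \<Sum>i\<in>UNIV. d \<nu> (L i \<alpha>) z * d \<sigma> (K i \<alpha>) z)
      + (\<Sum>\<alpha>\<in>UNIV. \<Sum>i\<in>UNIV. L i \<alpha> z * d \<nu> (d \<sigma> (K i \<alpha>)) z)" for \<nu> \<sigma>
  proof -
    have "d \<nu> (\<lambda>z. \<Sum>\<alpha>\<in>UNIV. \<Sum>i\<in>UNIV. L i \<alpha> z * d \<sigma> (K i \<alpha>) z) z
        = (\<Sum>\<alpha>\<in>UNIV. d \<nu> (\<lambda>z. \<Sum>i\<in>UNIV. L i \<alpha> z * d \<sigma> (K i \<alpha>) z) z)"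
      by (intro sum z smooths)
    also have "\<dots> = (\<Sum>\<alpha>\<in>UNIV. \<Sum>i\<in>UNIV. d \<nu> (\<lambda>z. L i \<alpha> z * d \<sigma> (K i \<alpha>) z) z)"
      by (intro sum.cong refl sum z smooths)
    also have "\<dots> = (\<Sum>\<alpha>\<in>UNIV. \<Sum>i\<in>UNIV. d \<nu> (L i \<alpha>) z * d \<sigma> (K i \<alpha>) z + L i \<alpha> z * d \<nu> (d \<sigma> (K i \<alpha>)) z)"
      by (intro sum.cong refl mult z smooths)
    finally show ?thesis by (simp add: sum.distrib)
  qed
  have dL: "d \<nu> (L i \<alpha>) z = - (\<Sum>j\<in>UNIV. \<Sum>\<beta>\<in>UNIV. L i \<beta> z * d \<nu> (K j \<beta>) z * L j \<alpha> z)" for \<nu> i \<alpha>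
  proof -
    have *: "(\<Sum>\<beta>\<in>UNIV. d \<nu> (L i \<beta>) z * K j \<beta> z) = - (\<Sum>\<beta>\<in>UNIV. L i \<beta> z * d \<nu> (K j \<beta>) z)" for j
    proof -
      \<comment> \<open>The Kronecker symbol is constant, so differentiating the duality relation
        gives zero; \<open>local\<close> carries the relation, known only on \<open>S\<close>, under
        the derivation.\<close>
      have "0 = d \<nu> (\<lambda>z. if i = j then 1 else 0) z"
        by (simp add: const z)
      also have "\<dots> = d \<nu> (\<lambda>z. \<Sum>\<beta>\<in>UNIV. L i \<beta> z * K j \<beta> z) z"
        by (rule local) (simp_all add: dual smooth_on_const z)
      also have "\<dots> = (\<Sum>\<beta>\<in>UNIV. d \<nu> (\<lambda>z. L i \<beta> z * K j \<beta> z) z)"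
        by (intro sum z smooths)
      also have "\<dots> = (\<Sum>\<beta>\<in>UNIV. d \<nu> (L i \<beta>) z * K j \<beta> z + L i \<beta> z * d \<nu> (K j \<beta>) z)"
        by (intro sum.cong refl mult z smooths)
      finally show ?thesis by (simp add: sum.distrib)
    qed
    \<comment> \<open>Inserting the identity matrix in the form \<open>dual'\<close> isolates the
      derivative of \<open>L\<close>.\<close>
    have "d \<nu> (L i \<alpha>) z = (\<Sum>\<beta>\<in>UNIV. d \<nu> (L i \<beta>) z * (\<Sum>j\<in>UNIV. K j \<beta> z * L j \<alpha> z))"
      by (simp add: dual' z if_distrib cong: if_cong)
    also have "\<dots> = (\<Sum>j\<in>UNIV. (\<Sum>\<beta>\<in>UNIV. d \<nu> (L i \<beta>) z * K j \<beta> z) * L j \<alpha> z)"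
      by (simp only: sum_distrib_left sum_distrib_right mult.assoc) (rule sum.swap)
    finally show ?thesis
      by (simp add: * sum_distrib_right sum_negf)
  qed
  have expand_dL: "(\<Sum>\<alpha>\<in>UNIV. \<Sum>i\<in>UNIV. d \<nu> (L i \<alpha>) z * d \<sigma> (K i \<alpha>) z)
      = - (\<Sum>(\<alpha>, i, j, \<beta>)\<in>UNIV. L i \<beta> z * d \<nu> (K j \<beta>) z * L j \<alpha> z * d \<sigma> (K i \<alpha>) z)" for \<nu> \<sigma>
    by (simp only: dL sum_distrib_right sum_negf mult_minus_left) (simp only: sum.cartesian_product UNIV_Times_UNIV)
  \<comment> \<open>Exchanging \<alpha> with \<beta> and \<open>i\<close> with \<open>j\<close>
    expresses the cyclicity of the trace. The map is its own inverse and so serves as both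
    witnesses.\<close>
  have "(\<Sum>(\<alpha>, i, j, \<beta>)\<in>UNIV. L i \<beta> z * d \<nu> (K j \<beta>) z * L j \<alpha> z * d \<sigma> (K i \<alpha>) z)
      = (\<Sum>(\<alpha>, i, j, \<beta>)\<in>UNIV. L i \<beta> z * d \<sigma> (K j \<beta>) z * L j \<alpha> z * d \<nu> (K i \<alpha>) z)"
    by (rule sum.reindex_bij_witness[where i = "\<lambda>(\<alpha>, i, j, \<beta>). (\<beta>, j, i, \<alpha>)" and j = "\<lambda>(\<alpha>, i, j, \<beta>). (\<beta>, j, i, \<alpha>)"])
      (auto simp: mult_ac)
  then show ?thesis
    unfolding expand expand_dL by (simp add: sum_subtractf right_diff_distrib)
qed

text \<open>In the trace the first and third terms cancel by symmetry of \<open>G\<close> and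
  \<open>g\<close>. The rest is half of \<open>tr (G dg)\<close>, which the product rule for
  \<open>g\<close> splits into two equal copies of \<open>tr (L dK)\<close>. Here \<open>G\<close>
  is the inverse metric at the single point \<open>z\<close>.\<close>

lemma trace_christoffel:
  fixes L K :: "'n::finite \<Rightarrow> 'n \<Rightarrow> 'v::real_normed_vector \<Rightarrow> real"
  assumes d: "\<And>\<nu>. derivation S (d \<nu>)"
    and K: "\<And>i \<alpha>. smooth_on S (K i \<alpha>)"
    and dual: "\<And>i j z. z \<in> S \<Longrightarrow> (\<Sum>\<beta>\<in>UNIV. L i \<beta> z * K j \<beta> z) = (if i = j then 1 else 0)"
    and g: "\<And>\<alpha> \<beta> z. g \<alpha> \<beta> z = (\<Sum>i\<in>UNIV. K i \<alpha> z * K i \<beta> z)"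
    and G: "\<And>\<alpha> \<beta>. G \<alpha> \<beta> = (\<Sum>i\<in>UNIV. L i \<alpha> z * L i \<beta> z)"
    and z: "z \<in> S"
  shows "(\<Sum>\<alpha>\<in>UNIV. 1/2 * (\<Sum>\<epsilon>\<in>UNIV. G \<alpha> \<epsilon> *
        (d \<alpha> (g \<sigma> \<epsilon>) z + d \<sigma> (g \<alpha> \<epsilon>) z - d \<epsilon> (g \<alpha> \<sigma>) z)))
    = (\<Sum>\<alpha>\<in>UNIV. \<Sum>i\<in>UNIV. L i \<alpha> z * d \<sigma> (K i \<alpha>) z)"
proof -
  interpret derivation S "d \<mu>" for \<mu> by (rule d)
  note smooths = smooth K open_S smooth_on_mult smooth_on_sum
  have G_sym: "G \<alpha> \<beta> = G \<beta> \<alpha>" for \<alpha> \<beta> by (simp add: G mult.commute)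
  have g_sym: "g \<alpha> \<beta> = g \<beta> \<alpha>" for \<alpha> \<beta> by (rule ext) (simp add: g mult.commute)
  have dg: "d \<sigma> (g \<alpha> \<epsilon>) z = (\<Sum>i\<in>UNIV. d \<sigma> (K i \<alpha>) z * K i \<epsilon> z) + (\<Sum>i\<in>UNIV. d \<sigma> (K i \<epsilon>) z * K i \<alpha> z)" for \<alpha> \<epsilon>
  proof -
    have "d \<sigma> (g \<alpha> \<epsilon>) z = (\<Sum>i\<in>UNIV. d \<sigma> (\<lambda>z. K i \<alpha> z * K i \<epsilon> z) z)"
      unfolding g[abs_def] by (intro sum z smooths)
    also have "\<dots> = (\<Sum>i\<in>UNIV. d \<sigma> (K i \<alpha>) z * K i \<epsilon> z + K i \<alpha> z * d \<sigma> (K i \<epsilon>) z)"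
      by (intro sum.cong refl mult z smooths)
    finally show ?thesis by (simp add: sum.distrib mult.commute)
  qed
  have half: "(\<Sum>\<alpha>\<in>UNIV. \<Sum>\<epsilon>\<in>UNIV. G \<alpha> \<epsilon> * (\<Sum>i\<in>UNIV. d \<sigma> (K i \<alpha>) z * K i \<epsilon> z))
      = (\<Sum>\<alpha>\<in>UNIV. \<Sum>i\<in>UNIV. L i \<alpha> z * d \<sigma> (K i \<alpha>) z)"
  proof (rule sum.cong[OF refl])
    fix \<alpha>
    \<comment> \<open>\<open>G\<close> raises the index of the coframe and thereby returns the
      frame.\<close>
    have GK: "(\<Sum>\<epsilon>\<in>UNIV. G \<alpha> \<epsilon> * K i \<epsilon> z) = L i \<alpha> z" for i
    proof -
      have "(\<Sum>\<epsilon>\<in>UNIV. G \<alpha> \<epsilon> * K i \<epsilon> z) = (\<Sum>j\<in>UNIV. L j \<alpha> z * (\<Sum>\<epsilon>\<in>UNIV. L j \<epsilon> z * K i \<epsilon> z))"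
        by (simp only: G sum_distrib_left sum_distrib_right, subst sum.swap) (simp add: mult_ac)
      then show ?thesis by (simp add: dual z if_distrib cong: if_cong)
    qed
    have "(\<Sum>\<epsilon>\<in>UNIV. G \<alpha> \<epsilon> * (\<Sum>i\<in>UNIV. d \<sigma> (K i \<alpha>) z * K i \<epsilon> z))
        = (\<Sum>i\<in>UNIV. d \<sigma> (K i \<alpha>) z * (\<Sum>\<epsilon>\<in>UNIV. G \<alpha> \<epsilon> * K i \<epsilon> z))"
      by (simp only: sum_distrib_left, subst sum.swap) (simp add: mult_ac)
    also have "\<dots> = (\<Sum>i\<in>UNIV. L i \<alpha> z * d \<sigma> (K i \<alpha>) z)"
      unfolding GK by (simp only: mult.commute)
    finally show "(\<Sum>\<epsilon>\<in>UNIV. G \<alpha> \<epsilon> * (\<Sum>i\<in>UNIV. d \<sigma> (K i \<alpha>) z * K i \<epsilon> z))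
        = (\<Sum>i\<in>UNIV. L i \<alpha> z * d \<sigma> (K i \<alpha>) z)" .
  qed
  have half': "(\<Sum>\<alpha>\<in>UNIV. \<Sum>\<epsilon>\<in>UNIV. G \<alpha> \<epsilon> * (\<Sum>i\<in>UNIV. d \<sigma> (K i \<epsilon>) z * K i \<alpha> z))
      = (\<Sum>\<alpha>\<in>UNIV. \<Sum>i\<in>UNIV. L i \<alpha> z * d \<sigma> (K i \<alpha>) z)"
    unfolding half[symmetric]
    by (subst sum.swap) (intro sum.cong refl arg_cong2[where f = "(*)"] G_sym)
  have "(\<Sum>\<alpha>\<in>UNIV. \<Sum>\<epsilon>\<in>UNIV. G \<alpha> \<epsilon> * d \<alpha> (g \<sigma> \<epsilon>) z) = (\<Sum>\<alpha>\<in>UNIV. \<Sum>\<epsilon>\<in>UNIV. G \<alpha> \<epsilon> * d \<epsilon> (g \<alpha> \<sigma>) z)"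
    by (subst sum.swap) (intro sum.cong refl arg_cong2[where f = "(*)"] G_sym, simp add: g_sym)
  moreover have "(\<Sum>\<alpha>\<in>UNIV. \<Sum>\<epsilon>\<in>UNIV. G \<alpha> \<epsilon> * d \<sigma> (g \<alpha> \<epsilon>) z)
      = 2 * (\<Sum>\<alpha>\<in>UNIV. \<Sum>i\<in>UNIV. L i \<alpha> z * d \<sigma> (K i \<alpha>) z)"
    unfolding dg distrib_left sum.distrib half half' by simp
  ultimately show ?thesis
    unfolding sum_distrib_left[symmetric]
    by (simp only: distrib_left right_diff_distrib sum.distrib sum_subtractf)
qed

section \<open>Contracted curvatures\<close>

text \<open>The coefficient terms of the two covariant derivatives differ by a torsion contraction,
  which the third summand compensates. With its vertical analogue this turns the covariant
  derivatives in (a) and (b) into plain curls.\<close>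

lemma h_cov_curl:
  "h_cov D w \<sigma> \<nu> z - h_cov D w \<nu> \<sigma> z + (\<Sum>\<epsilon>\<in>UNIV. w \<epsilon> z * h_torsion D \<epsilon> \<sigma> \<nu> z)
    = delta (Nco D) \<nu> (w \<sigma>) z - delta (Nco D) \<sigma> (w \<nu>) z"
  by (simp add: h_cov_def h_torsion_def right_diff_distrib sum_subtractf)

lemma v_cov_curl:
  "v_cov D w \<sigma> \<nu> z - v_cov D w \<nu> \<sigma> z + (\<Sum>\<epsilon>\<in>UNIV. w \<epsilon> z * v_torsion D \<epsilon> \<sigma> \<nu> z)
    = d_y \<nu> (w \<sigma>) z - d_y \<sigma> (w \<nu>) z"
  by (simp add: v_cov_def v_torsion_def right_diff_distrib sum_subtractf)

section \<open>Traces of the dual and symmetric connections\<close>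

lemma Nco_dual: "Nco (dual_conn D) = Nco D"
  by (simp add: dual_conn_def)

lemma Nco_symmetric: "Nco (symmetric_conn D) = Nco D"
  by (simp add: symmetric_conn_def)

lemma dual_h_trace: "(\<Sum>\<alpha>\<in>UNIV. Hco (dual_conn D) \<alpha> \<alpha> \<sigma> z)
    = (\<Sum>\<alpha>\<in>UNIV. Hco D \<alpha> \<alpha> \<sigma> z) + h_torsion_trace D \<sigma> z"
  by (simp add: dual_conn_def h_torsion_trace_def h_torsion_def sum_subtractf)

lemma dual_v_trace: "(\<Sum>\<alpha>\<in>UNIV. Vco (dual_conn D) \<alpha> \<alpha> \<sigma> z)
    = (\<Sum>\<alpha>\<in>UNIV. Vco D \<alpha> \<alpha> \<sigma> z) + v_torsion_trace D \<sigma> z"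
  by (simp add: dual_conn_def v_torsion_trace_def v_torsion_def sum_subtractf)

lemma symmetric_h_trace: "(\<Sum>\<alpha>\<in>UNIV. Hco (symmetric_conn D) \<alpha> \<alpha> \<sigma> z)
    = (\<Sum>\<alpha>\<in>UNIV. Hco D \<alpha> \<alpha> \<sigma> z) + 1/2 * h_torsion_trace D \<sigma> z"
  by (simp add: symmetric_conn_def h_torsion_trace_def h_torsion_def sum_subtractf sum.distrib
      sum_divide_distrib[symmetric] field_simps)

lemma symmetric_v_trace: "(\<Sum>\<alpha>\<in>UNIV. Vco (symmetric_conn D) \<alpha> \<alpha> \<sigma> z)
    = (\<Sum>\<alpha>\<in>UNIV. Vco D \<alpha> \<alpha> \<sigma> z) + 1/2 * v_torsion_trace D \<sigma> z"
  by (simp add: symmetric_conn_def v_torsion_trace_def v_torsion_def sum_subtractf sum.distrib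
      sum_divide_distrib[symmetric] field_simps)

text \<open>Formulated for any d-connection with smooth coefficients, because the contraction
  formulas are applied to the canonical, dual, symmetric and Riemannian ones alike.\<close>

locale smooth_d_connection =
  fixes S :: "((real^'n) \<times> (real^'n)) set" and D :: "'n::finite d_connection"
  assumes open_S: "open S"
    and smooth_N: "smooth_on S (Nco D \<alpha> \<mu>)"
    and smooth_H: "smooth_on S (Hco D \<alpha> \<mu> \<nu>)"
    and smooth_V: "smooth_on S (Vco D \<alpha> \<mu> \<nu>)"
begin

sublocale h: derivation S "delta (Nco D) \<mu>" for \<mu>
  by (rule derivation_delta[OF open_S smooth_N])

sublocale v: derivation S "d_y \<mu>" for \<mu>
  by (rule derivation_d_y[OF open_S])

lemma h_contraction_eq:
  assumes z: "z \<in> S"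
  shows "h_contraction D \<sigma> \<nu> z =
    delta (Nco D) \<nu> (\<lambda>z. \<Sum>\<alpha>\<in>UNIV. Hco D \<alpha> \<alpha> \<sigma> z) z - delta (Nco D) \<sigma> (\<lambda>z. \<Sum>\<alpha>\<in>UNIV. Hco D \<alpha> \<alpha> \<nu> z) z
    + (\<Sum>\<epsilon>\<in>UNIV. (\<Sum>\<alpha>\<in>UNIV. Vco D \<alpha> \<alpha> \<epsilon> z) * N_curvature (Nco D) \<epsilon> \<sigma> \<nu> z)"
proof -
  \<comment> \<open>Both sides are traces of a product of the same two matrices; exchanging \<alpha>
    and \<epsilon> reverses the factors.\<close>
  have "(\<Sum>\<alpha>\<in>UNIV. \<Sum>\<epsilon>\<in>UNIV. Hco D \<epsilon> \<alpha> \<sigma> z * Hco D \<alpha> \<epsilon> \<nu> z)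
      = (\<Sum>\<alpha>\<in>UNIV. \<Sum>\<epsilon>\<in>UNIV. Hco D \<epsilon> \<alpha> \<nu> z * Hco D \<alpha> \<epsilon> \<sigma> z)"
    by (subst sum.swap) (simp only: mult.commute)
  moreover have "(\<Sum>\<alpha>\<in>UNIV. \<Sum>\<epsilon>\<in>UNIV. Vco D \<alpha> \<alpha> \<epsilon> z * N_curvature (Nco D) \<epsilon> \<sigma> \<nu> z)
      = (\<Sum>\<epsilon>\<in>UNIV. (\<Sum>\<alpha>\<in>UNIV. Vco D \<alpha> \<alpha> \<epsilon> z) * N_curvature (Nco D) \<epsilon> \<sigma> \<nu> z)"
    by (subst sum.swap) (simp only: sum_distrib_right)
  ultimately show ?thesis
    by (simp add: h_contraction_def h_curvature_def h.sum smooth_H z sum.distrib sum_subtractf)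
qed

lemma v_contraction_eq:
  assumes z: "z \<in> S"
  shows "v_contraction D \<sigma> \<nu> z =
    d_y \<nu> (\<lambda>z. \<Sum>\<alpha>\<in>UNIV. Vco D \<alpha> \<alpha> \<sigma> z) z - d_y \<sigma> (\<lambda>z. \<Sum>\<alpha>\<in>UNIV. Vco D \<alpha> \<alpha> \<nu> z) z"
proof -
  have "(\<Sum>\<alpha>\<in>UNIV. \<Sum>\<epsilon>\<in>UNIV. Vco D \<epsilon> \<alpha> \<sigma> z * Vco D \<alpha> \<epsilon> \<nu> z)
      = (\<Sum>\<alpha>\<in>UNIV. \<Sum>\<epsilon>\<in>UNIV. Vco D \<epsilon> \<alpha> \<nu> z * Vco D \<alpha> \<epsilon> \<sigma> z)"
    by (subst sum.swap) (simp only: mult.commute)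
  then show ?thesis
    by (simp add: v_contraction_def v_curvature_def v.sum smooth_V z sum.distrib sum_subtractf)
qed

lemma smooth_h_trace: "smooth_on S (\<lambda>z. \<Sum>\<alpha>\<in>UNIV. Hco D \<alpha> \<alpha> \<sigma> z)"
  by (intro smooth_on_sum open_S smooth_H)

lemma smooth_v_trace: "smooth_on S (\<lambda>z. \<Sum>\<alpha>\<in>UNIV. Vco D \<alpha> \<alpha> \<sigma> z)"
  by (intro smooth_on_sum open_S smooth_V)

lemma smooth_h_torsion_trace: "smooth_on S (h_torsion_trace D \<sigma>)"
  unfolding h_torsion_trace_def[abs_def] h_torsion_def
  by (intro smooth_on_sum smooth_on_diff open_S smooth_H)

lemma smooth_v_torsion_trace: "smooth_on S (v_torsion_trace D \<sigma>)"
  unfolding v_torsion_trace_def[abs_def] v_torsion_def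
  by (intro smooth_on_sum smooth_on_diff open_S smooth_V)

lemma smooth_dual_conn: "smooth_d_connection S (dual_conn D)"
  by unfold_locales (simp_all add: dual_conn_def open_S smooth_N smooth_H smooth_V)

lemma smooth_symmetric_conn: "smooth_d_connection S (symmetric_conn D)"
  by unfold_locales
    (simp_all only: symmetric_conn_def d_connection.sel,
      (intro smooth_on_mult smooth_on_add smooth_on_const open_S smooth_N smooth_H smooth_V)+)

text \<open>For fixed \<open>N\<close> the contraction formula is linear in the traces, and
  dualizing adds the torsion traces to them. The added bracket is that formula evaluated on the
  torsion traces.\<close>

lemma h_contraction_dual_conn:
  assumes z: "z \<in> S"
  shows "h_contraction (dual_conn D) \<sigma> \<nu> z = h_contraction D \<sigma> \<nu> z
    + (delta (Nco D) \<nu> (h_torsion_trace D \<sigma>) z - delta (Nco D) \<sigma> (h_torsion_trace D \<nu>) z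
      + (\<Sum>\<epsilon>\<in>UNIV. v_torsion_trace D \<epsilon> z * N_curvature (Nco D) \<epsilon> \<sigma> \<nu> z))"
  unfolding h_contraction_eq[OF z] smooth_d_connection.h_contraction_eq[OF smooth_dual_conn z]
    dual_h_trace dual_v_trace Nco_dual
  by (simp add: h.add smooth_h_trace smooth_h_torsion_trace z distrib_right sum.distrib)

lemma v_contraction_dual_conn:
  assumes z: "z \<in> S"
  shows "v_contraction (dual_conn D) \<sigma> \<nu> z = v_contraction D \<sigma> \<nu> z
    + (d_y \<nu> (v_torsion_trace D \<sigma>) z - d_y \<sigma> (v_torsion_trace D \<nu>) z)"
  unfolding v_contraction_eq[OF z] smooth_d_connection.v_contraction_eq[OF smooth_dual_conn z] dual_v_trace
  by (simp add: v.add smooth_v_trace smooth_v_torsion_trace z)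

text \<open>The traces of the symmetric connection are the means of those of \<open>D\<close> and
  its dual, and the contraction formula is linear in them. When the contraction of \<open>D\<close>
  vanishes, this is (c).\<close>

lemma h_contraction_symmetric_conn:
  assumes z: "z \<in> S"
  shows "h_contraction (symmetric_conn D) \<sigma> \<nu> z
    = 1/2 * (h_contraction D \<sigma> \<nu> z + h_contraction (dual_conn D) \<sigma> \<nu> z)"
proof -
  have delta_trace: "delta (Nco D) \<nu> (\<lambda>z. (\<Sum>\<alpha>\<in>UNIV. Hco D \<alpha> \<alpha> \<sigma> z) + 1/2 * h_torsion_trace D \<sigma> z) z
      = delta (Nco D) \<nu> (\<lambda>z. \<Sum>\<alpha>\<in>UNIV. Hco D \<alpha> \<alpha> \<sigma> z) z + 1/2 * delta (Nco D) \<nu> (h_torsion_trace D \<sigma>) z"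
    for \<nu> \<sigma>
    using h.add[OF smooth_h_trace smooth_on_mult[OF open_S smooth_on_const smooth_h_torsion_trace] z]
      h.cmult[OF smooth_h_torsion_trace z] by metis
  have curvature_term: "(\<Sum>\<epsilon>\<in>UNIV. ((\<Sum>\<alpha>\<in>UNIV. Vco D \<alpha> \<alpha> \<epsilon> z) + 1/2 * v_torsion_trace D \<epsilon> z) * N_curvature (Nco D) \<epsilon> \<sigma> \<nu> z)
      = (\<Sum>\<epsilon>\<in>UNIV. (\<Sum>\<alpha>\<in>UNIV. Vco D \<alpha> \<alpha> \<epsilon> z) * N_curvature (Nco D) \<epsilon> \<sigma> \<nu> z)
      + 1/2 * (\<Sum>\<epsilon>\<in>UNIV. v_torsion_trace D \<epsilon> z * N_curvature (Nco D) \<epsilon> \<sigma> \<nu> z)"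
    by (simp only: distrib_right sum.distrib sum_distrib_left mult.assoc)
  show ?thesis
    unfolding h_contraction_dual_conn[OF z] h_contraction_eq[OF z]
      smooth_d_connection.h_contraction_eq[OF smooth_symmetric_conn z]
      symmetric_h_trace symmetric_v_trace Nco_symmetric delta_trace curvature_term
    by (simp add: field_simps)
qed

lemma v_contraction_symmetric_conn:
  assumes z: "z \<in> S"
  shows "v_contraction (symmetric_conn D) \<sigma> \<nu> z
    = 1/2 * (v_contraction D \<sigma> \<nu> z + v_contraction (dual_conn D) \<sigma> \<nu> z)"
proof -
  have "d_y \<nu> (\<lambda>z. (\<Sum>\<alpha>\<in>UNIV. Vco D \<alpha> \<alpha> \<sigma> z) + 1/2 * v_torsion_trace D \<sigma> z) z
      = d_y \<nu> (\<lambda>z. \<Sum>\<alpha>\<in>UNIV. Vco D \<alpha> \<alpha> \<sigma> z) z + 1/2 * d_y \<nu> (v_torsion_trace D \<sigma>) z"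
    for \<nu> \<sigma>
    using v.add[OF smooth_v_trace smooth_on_mult[OF open_S smooth_on_const smooth_v_torsion_trace] z]
      v.cmult[OF smooth_v_torsion_trace z] by metis
  then show ?thesis
    unfolding v_contraction_dual_conn[OF z] v_contraction_eq[OF z]
      smooth_d_connection.v_contraction_eq[OF smooth_symmetric_conn z] symmetric_v_trace
    by (simp add: field_simps)
qed

end

section \<open>Local frames\<close>

lemma matrix_inv_works:
  fixes A :: "real^'n^'n"
  assumes "det A \<noteq> 0"
  shows "A ** matrix_inv A = mat 1" "matrix_inv A ** A = mat 1"
  using assms someI_ex[of "\<lambda>B. A ** B = mat 1 \<and> B ** A = mat 1"]
  unfolding invertible_det_nz[symmetric] invertible_def matrix_inv_def by blast+

lemma matrix_inv_eqI:
  fixes A B :: "real^'n^'n"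
  assumes "A ** B = mat 1"
  shows "matrix_inv A = B"
proof -
  have "det A \<noteq> 0"
    using assms invertible_right_inverse invertible_det_nz by blast
  then have "matrix_inv A ** (A ** B) = B"
    by (simp add: matrix_mul_assoc matrix_inv_works)
  then show ?thesis by (simp add: assms)
qed

text \<open>The data of a GAP-space in one induced chart. Nondegeneracy is imposed on an open set,
  since the coframe has to be differentiated.\<close>

locale local_frame =
  fixes S :: "((real^'n) \<times> (real^'n)) set"
    and L N :: "'n::finite \<Rightarrow> 'n \<Rightarrow> 'n lfun"
  assumes open_S: "open S"
    and smooth_L: "smooth_on S (L i \<alpha>)"
    and smooth_N: "smooth_on S (N \<alpha> \<mu>)"
    and det_L: "z \<in> S \<Longrightarrow> det (\<chi> i \<alpha>. L i \<alpha> z) \<noteq> 0"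
begin

sublocale h: derivation S "delta N \<mu>" for \<mu>
  by (rule derivation_delta[OF open_S smooth_N])

sublocale v: derivation S "d_y \<mu>" for \<mu>
  by (rule derivation_d_y[OF open_S])

lemma frame_coframe: "z \<in> S \<Longrightarrow> (\<Sum>\<beta>\<in>UNIV. L i \<beta> z * coframe L j \<beta> z) = (if i = j then 1 else 0)"
  using matrix_inv_works(1)[OF det_L[of z]]
  by (simp add: vec_eq_iff matrix_matrix_mult_def mat_def coframe_def)

lemma coframe_frame: "z \<in> S \<Longrightarrow> (\<Sum>i\<in>UNIV. coframe L i \<alpha> z * L i \<beta> z) = (if \<alpha> = \<beta> then 1 else 0)"
  using matrix_inv_works(2)[OF det_L[of z]]
  by (simp add: vec_eq_iff matrix_matrix_mult_def mat_def coframe_def)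

text \<open>By Cramer's rule a coframe component is a quotient of determinants with smooth entries
  and nonvanishing denominator.\<close>

lemma smooth_coframe: "smooth_on S (coframe L i \<alpha>)"
proof (rule smooth_on_cong[OF _ open_S])
  \<comment> \<open>The frame matrix with column \<alpha> replaced by the \<open>i\<close>-th unit
    vector, the numerator matrix in Cramer's rule.\<close>
  let ?F = "\<lambda>j \<beta> z. if \<beta> = \<alpha> then (if j = i then 1 else 0) else L j \<beta> z"
  have "smooth_on S (?F j \<beta>)" for j \<beta>
    by (cases "\<beta> = \<alpha>") (simp_all add: smooth_on_const smooth_L)
  then show "smooth_on S (\<lambda>z. det (\<chi> j \<beta>. ?F j \<beta> z) * inverse (det (\<chi> j \<beta>. L j \<beta> z)))"
    by (intro smooth_on_mult smooth_on_inverse smooth_on_det open_S smooth_L det_L)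
  fix z assume z: "z \<in> S"
  let ?A = "\<chi> j \<beta>. L j \<beta> z"
  have "?A *v (\<chi> \<beta>. coframe L i \<beta> z) = axis i 1"
    using frame_coframe[OF z] by (simp add: vec_eq_iff matrix_vector_mult_def axis_def)
  then have "(\<chi> \<beta>. coframe L i \<beta> z) $ \<alpha>
      = det (\<chi> j \<beta>. if \<beta> = \<alpha> then axis i 1 $ j else ?A $ j $ \<beta>) / det ?A"
    by (simp add: cramer[OF det_L[OF z]])
  then show "det (\<chi> j \<beta>. ?F j \<beta> z) * inverse (det (\<chi> j \<beta>. L j \<beta> z)) = coframe L i \<alpha> z"
    by (simp add: axis_def divide_inverse cong: if_cong)
qed

text \<open>Contracting the metric with the frame gives the coframe, and contracting once more with
  the frame gives the identity. The formula makes the inverse metric visibly smooth and provides the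
  \<open>G\<close> of \<open>trace_christoffel\<close>.\<close>

lemma inv_metric_eq:
  assumes z: "z \<in> S"
  shows "inv_metric L \<alpha> \<beta> z = (\<Sum>i\<in>UNIV. L i \<alpha> z * L i \<beta> z)"
proof -
  have "(\<Sum>\<beta>\<in>UNIV. metric L \<alpha> \<beta> z * (\<Sum>i\<in>UNIV. L i \<beta> z * L i \<gamma> z)) = (if \<alpha> = \<gamma> then 1 else 0)" for \<alpha> \<gamma>
  proof -
    have "(\<Sum>\<beta>\<in>UNIV. metric L \<alpha> \<beta> z * (\<Sum>i\<in>UNIV. L i \<beta> z * L i \<gamma> z))
        = (\<Sum>i\<in>UNIV. L i \<gamma> z * (\<Sum>\<beta>\<in>UNIV. metric L \<alpha> \<beta> z * L i \<beta> z))"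
      by (simp only: sum_distrib_left, subst sum.swap) (simp add: mult_ac)
    also have "\<dots> = (\<Sum>i\<in>UNIV. L i \<gamma> z * coframe L i \<alpha> z)"
    proof (intro sum.cong refl arg_cong2[where f = "(*)"])
      fix i
      have "(\<Sum>\<beta>\<in>UNIV. metric L \<alpha> \<beta> z * L i \<beta> z)
          = (\<Sum>j\<in>UNIV. coframe L j \<alpha> z * (\<Sum>\<beta>\<in>UNIV. L i \<beta> z * coframe L j \<beta> z))"
        by (simp only: metric_def sum_distrib_left sum_distrib_right, subst sum.swap) (simp add: mult_ac)
      then show "(\<Sum>\<beta>\<in>UNIV. metric L \<alpha> \<beta> z * L i \<beta> z) = coframe L i \<alpha> z"
        by (simp add: frame_coframe z if_distrib cong: if_cong)
    qed
    also have "\<dots> = (if \<alpha> = \<gamma> then 1 else 0)"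
      by (subst mult.commute) (rule coframe_frame[OF z])
    finally show ?thesis .
  qed
  then have "(\<chi> \<alpha> \<beta>. metric L \<alpha> \<beta> z) ** (\<chi> \<alpha> \<beta>. \<Sum>i\<in>UNIV. L i \<alpha> z * L i \<beta> z) = mat 1"
    by (simp add: vec_eq_iff matrix_matrix_mult_def mat_def)
  then show ?thesis
    by (simp add: inv_metric_def matrix_inv_eqI)
qed

lemma smooth_metric: "smooth_on S (metric L \<alpha> \<beta>)"
  unfolding metric_def[abs_def] by (intro smooth_on_sum smooth_on_mult open_S smooth_coframe)

lemma smooth_inv_metric: "smooth_on S (inv_metric L \<alpha> \<beta>)"
proof (rule smooth_on_cong[OF _ open_S])
  show "smooth_on S (\<lambda>z. \<Sum>i\<in>UNIV. L i \<alpha> z * L i \<beta> z)"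
    by (intro smooth_on_sum smooth_on_mult open_S smooth_L)
qed (simp add: inv_metric_eq)

sublocale canonical: smooth_d_connection S "canonical_conn N L"
  by unfold_locales
    (simp_all only: canonical_conn_def d_connection.sel,
      (intro open_S smooth_N smooth_L smooth_on_sum smooth_on_mult h.smooth v.smooth smooth_coframe)+)

sublocale riemannian: smooth_d_connection S "riemannian_conn N L"
  by unfold_locales
    (simp_all only: riemannian_conn_def d_connection.sel,
      (intro open_S smooth_N smooth_on_sum smooth_on_mult smooth_on_add smooth_on_diff smooth_on_const
        h.smooth v.smooth smooth_metric smooth_inv_metric)+)

text \<open>\<open>curl_trace_inverse_derivative\<close> stands in for applying the commutator to
  the logarithm of the determinant. It reduces the curl of the trace to commutators of
  \<open>delta\<close> on the coframe, whose curvature terms cancel the vertical trace term.\<close>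

lemma h_contraction_canonical: "h_contraction (canonical_conn N L) \<sigma> \<nu> z = 0" if z: "z \<in> S"
proof -
  have "(\<Sum>\<epsilon>\<in>UNIV. (\<Sum>\<alpha>\<in>UNIV. \<Sum>i\<in>UNIV. L i \<alpha> z * d_y \<epsilon> (coframe L i \<alpha>) z) * N_curvature N \<epsilon> \<sigma> \<nu> z)
      = (\<Sum>\<alpha>\<in>UNIV. \<Sum>\<epsilon>\<in>UNIV. \<Sum>i\<in>UNIV. L i \<alpha> z * d_y \<epsilon> (coframe L i \<alpha>) z * N_curvature N \<epsilon> \<sigma> \<nu> z)"
    by (simp only: sum_distrib_right) (rule sum.swap)
  also have "\<dots> = (\<Sum>\<alpha>\<in>UNIV. \<Sum>i\<in>UNIV. L i \<alpha> z * (\<Sum>\<epsilon>\<in>UNIV. N_curvature N \<epsilon> \<sigma> \<nu> z * d_y \<epsilon> (coframe L i \<alpha>) z))"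
    by (rule sum.cong[OF refl], subst sum.swap) (simp add: sum_distrib_left mult_ac)
  finally show ?thesis
    using curl_trace_inverse_derivative[where d = "delta N" and \<nu> = \<nu> and \<sigma> = \<sigma>,
        OF h.derivation_axioms smooth_L smooth_coframe frame_coframe coframe_frame z]
    by (simp add: canonical.h_contraction_eq[OF z] delta_commutator[OF open_S smooth_N smooth_coframe z] sum_negf)
      (simp add: canonical_conn_def)
qed

text \<open>Vertical derivatives commute, so the commutators to which the curl reduces are all
  zero.\<close>

lemma v_contraction_canonical: "v_contraction (canonical_conn N L) \<sigma> \<nu> z = 0" if z: "z \<in> S"
  using curl_trace_inverse_derivative[where d = "d_y" and \<nu> = \<nu> and \<sigma> = \<sigma>,
        OF v.derivation_axioms smooth_L smooth_coframe frame_coframe coframe_frame z]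
  by (simp add: canonical.v_contraction_eq[OF z] d_y_commute[OF open_S smooth_coframe z, of \<nu> \<sigma>])
    (simp add: canonical_conn_def)

lemma riemannian_h_trace:
  "z \<in> S \<Longrightarrow> (\<Sum>\<alpha>\<in>UNIV. Hco (riemannian_conn N L) \<alpha> \<alpha> \<sigma> z) = (\<Sum>\<alpha>\<in>UNIV. Hco (canonical_conn N L) \<alpha> \<alpha> \<sigma> z)"
  unfolding riemannian_conn_def canonical_conn_def d_connection.sel
  by (rule trace_christoffel[OF h.derivation_axioms smooth_coframe frame_coframe metric_def inv_metric_eq])

lemma riemannian_v_trace:
  "z \<in> S \<Longrightarrow> (\<Sum>\<alpha>\<in>UNIV. Vco (riemannian_conn N L) \<alpha> \<alpha> \<sigma> z) = (\<Sum>\<alpha>\<in>UNIV. Vco (canonical_conn N L) \<alpha> \<alpha> \<sigma> z)"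
  unfolding riemannian_conn_def canonical_conn_def d_connection.sel
  by (rule trace_christoffel[OF v.derivation_axioms smooth_coframe frame_coframe metric_def inv_metric_eq])

text \<open>The traces agree with the canonical ones on the whole open set \<open>S\<close>, so by
  locality their derivatives agree as well, and with them the contractions.\<close>

lemma h_contraction_riemannian: "h_contraction (riemannian_conn N L) \<sigma> \<nu> z = 0" if z: "z \<in> S"
proof -
  have Nco: "Nco (riemannian_conn N L) = N" "Nco (canonical_conn N L) = N"
    by (simp_all add: riemannian_conn_def canonical_conn_def)
  have "delta N \<nu> (\<lambda>z. \<Sum>\<alpha>\<in>UNIV. Hco (riemannian_conn N L) \<alpha> \<alpha> \<sigma> z) z
      = delta N \<nu> (\<lambda>z. \<Sum>\<alpha>\<in>UNIV. Hco (canonical_conn N L) \<alpha> \<alpha> \<sigma> z) z" for \<nu> \<sigma>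
    by (rule h.local[OF riemannian.smooth_h_trace riemannian_h_trace z])
  then have "h_contraction (riemannian_conn N L) \<sigma> \<nu> z = h_contraction (canonical_conn N L) \<sigma> \<nu> z"
    by (simp only: riemannian.h_contraction_eq[OF z] canonical.h_contraction_eq[OF z] Nco riemannian_v_trace[OF z])
  then show ?thesis using h_contraction_canonical[OF z] by simp
qed

lemma v_contraction_riemannian: "v_contraction (riemannian_conn N L) \<sigma> \<nu> z = 0" if z: "z \<in> S"
proof -
  have "d_y \<nu> (\<lambda>z. \<Sum>\<alpha>\<in>UNIV. Vco (riemannian_conn N L) \<alpha> \<alpha> \<sigma> z) z
      = d_y \<nu> (\<lambda>z. \<Sum>\<alpha>\<in>UNIV. Vco (canonical_conn N L) \<alpha> \<alpha> \<sigma> z) z" for \<nu> \<sigma>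
    by (rule v.local[OF riemannian.smooth_v_trace riemannian_v_trace z])
  then have "v_contraction (riemannian_conn N L) \<sigma> \<nu> z = v_contraction (canonical_conn N L) \<sigma> \<nu> z"
    by (simp only: riemannian.v_contraction_eq[OF z] canonical.v_contraction_eq[OF z])
  then show ?thesis using v_contraction_canonical[OF z] by simp
qed

end

text \<open>Independence in \<open>gap_space\<close> concerns tangent vectors as families over all
  charts. A relation between the components in \<open>c\<close> passes to every other chart around
  the point through the Jacobian, and elsewhere all components are zero by convention; hence the
  rows of the matrix are independent.\<close>

lemma gap_space_det_nonzero:
  fixes A :: "('a, 'n::finite) chart set"
  assumes gap: "gap_space M A lam" and c: "c \<in> A" and z: "z \<in> induced_coord c ` induced_dom M A c"
  shows "det (\<chi> i \<alpha>. components M A c (lam i) \<alpha> z) \<noteq> 0"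
proof -
  \<comment> \<open>The point of the tangent bundle at which \<open>components\<close> evaluates the
    sections for the coordinates \<open>z\<close>.\<close>
  define u where "u = inv_into (induced_dom M A c) (induced_coord c) z"
  have "u \<in> induced_dom M A c" using z unfolding u_def by (rule inv_into_into)
  then have u: "u \<in> TM M A" "fst u \<in> fst c" by (auto simp: induced_dom_def)
  have tangent: "lam i u \<in> tangent_space A (fst u)" for i
    using gap u(1) by (auto simp: gap_space_def pullback_section_def)
  let ?A = "\<chi> i \<alpha>. components M A c (lam i) \<alpha> z"
  have "\<forall>a. (\<Sum>i\<in>UNIV. a i *s row i ?A) = 0 \<longrightarrow> (\<forall>i. a i = 0)"
  proof (intro allI impI)
    fix a :: "'n \<Rightarrow> real" and i
    assume "(\<Sum>i\<in>UNIV. a i *s row i ?A) = 0"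
    then have at_c: "(\<Sum>i\<in>UNIV. a i * lam i u c $ \<alpha>) = 0" for \<alpha>
      by (simp add: vec_eq_iff row_def components_def u_def)
    have "(\<Sum>i\<in>UNIV. a i *\<^sub>R lam i u c') = 0" for c'
    proof (cases "c' \<in> A \<and> fst u \<in> fst c'")
      case True
      have change: "lam i u c' $ \<beta> = (\<Sum>\<alpha>\<in>UNIV. jac c c' \<beta> \<alpha> (snd c (fst u)) * lam i u c $ \<alpha>)" for i \<beta>
        using tangent[of i] True c u(2) unfolding tangent_space_def by blast
      have "(\<Sum>i\<in>UNIV. a i * lam i u c' $ \<beta>)
          = (\<Sum>\<alpha>\<in>UNIV. jac c c' \<beta> \<alpha> (snd c (fst u)) * (\<Sum>i\<in>UNIV. a i * lam i u c $ \<alpha>))" for \<beta>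
        by (simp only: change sum_distrib_left, subst sum.swap) (simp add: mult_ac)
      then show ?thesis by (simp add: vec_eq_iff at_c)
    next
      case False
      then have "lam i u c' = 0" for i
        using tangent[of i] unfolding tangent_space_def by blast
      then show ?thesis by simp
    qed
    then show "a i = 0" using gap u(1) by (auto simp: gap_space_def)
  qed
  then show ?thesis
    unfolding matrix_right_invertible_independent_rows[symmetric]
    using invertible_right_inverse invertible_det_nz by blast
qed

theorem proposition6p1:
  fixes M :: "'a topology"
    and A :: "('a, 'n::finite) chart set"
    and lam :: "'n \<Rightarrow> 'a \<times> ('a, 'n) tvec \<Rightarrow> ('a, 'n) tvec"
    and N :: "('a, 'n) chart \<Rightarrow> 'n \<Rightarrow> 'n \<Rightarrow> 'n lfun"
    and c :: "('a, 'n) chart"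
    and u :: "'a \<times> ('a, 'n) tvec"
    and \<sigma> \<nu> :: 'n
  assumes gap: "gap_space M A lam"
    and conn: "nonlinear_connection M A N"
    and chart: "c \<in> A"
    and point: "u \<in> induced_dom M A c"
  shows "let z = induced_coord c u;
             L = (\<lambda>i. components M A c (lam i));
             D = canonical_conn (N c) L;
             D_dual = dual_conn D;
             D_sym = symmetric_conn D;
             D_riem = riemannian_conn (N c) L;
             \<Lambda> = h_torsion D;
             T = v_torsion D;
             \<beta> = h_torsion_trace D;
             B = v_torsion_trace D;
             R = N_curvature (N c)
         in h_contraction D_dual \<sigma> \<nu> z =
              h_cov D \<beta> \<sigma> \<nu> z - h_cov D \<beta> \<nu> \<sigma> z
              + (\<Sum>\<epsilon>\<in>UNIV. \<beta> \<epsilon> z * \<Lambda> \<epsilon> \<sigma> \<nu> z) + (\<Sum>\<epsilon>\<in>UNIV. B \<epsilon> z * R \<epsilon> \<sigma> \<nu> z)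
          \<and> v_contraction D_dual \<sigma> \<nu> z =
              v_cov D B \<sigma> \<nu> z - v_cov D B \<nu> \<sigma> z + (\<Sum>\<epsilon>\<in>UNIV. B \<epsilon> z * T \<epsilon> \<sigma> \<nu> z)
          \<and> h_contraction D_sym \<sigma> \<nu> z = 1/2 * h_contraction D_dual \<sigma> \<nu> z
          \<and> v_contraction D_sym \<sigma> \<nu> z = 1/2 * v_contraction D_dual \<sigma> \<nu> z
          \<and> h_contraction D_riem \<sigma> \<nu> z = 0 \<and> v_contraction D_riem \<sigma> \<nu> z = 0"
proof -
  let ?z = "induced_coord c u" and ?L = "\<lambda>i. components M A c (lam i)"
  \<comment> \<open>By continuity of the determinant it is enough to have a frame at \<open>?z\<close>; that the induced
    coordinates map onto all of \<open>T\<close>, hence that \<open>S = T\<close>, is not needed.\<close>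
  define T where "T = chart_image c \<times> (UNIV :: (real^'n) set)"
  define S where "S = {z \<in> T. det (\<chi> i \<alpha>. ?L i \<alpha> z) \<noteq> 0}"
  have "open T"
    using gap chart by (auto simp: T_def gap_space_def smooth_manifold_def intro!: open_Times)
  have L: "smooth_on T (?L i \<alpha>)" for i \<alpha>
    using gap chart by (auto simp: T_def gap_space_def pullback_section_def)
  have N: "smooth_on T (N c \<alpha> \<beta>)" for \<alpha> \<beta>
    using conn chart by (auto simp: T_def nonlinear_connection_def)
  have "S = T \<inter> (\<lambda>z. det (\<chi> i \<alpha>. ?L i \<alpha> z)) -` (- {0})"
    by (auto simp: S_def)
  moreover have "continuous_on T (\<lambda>z. det (\<chi> i \<alpha>. ?L i \<alpha> z))"
    by (intro smooth_on_imp_continuous_on smooth_on_det \<open>open T\<close> L)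
  ultimately have "open S"
    by (simp add: continuous_open_preimage \<open>open T\<close> open_Compl)
  have z: "?z \<in> S"
    using gap_space_det_nonzero[OF gap chart imageI[OF point]] point
    by (auto simp: S_def T_def induced_coord_def induced_dom_def chart_image_def)
  interpret local_frame S ?L "N c"
  proof
    show "smooth_on S (?L i \<alpha>)" "smooth_on S (N c i \<alpha>)" for i \<alpha>
      by (rule smooth_on_subset[OF L] smooth_on_subset[OF N]; simp add: S_def)+
  qed (use \<open>open S\<close> in \<open>auto simp: S_def\<close>)
  let ?D = "canonical_conn (N c) ?L"
  have Nco: "Nco ?D = N c" by (simp add: canonical_conn_def)
  \<comment> \<open>The canonical contractions vanish, so the mean of canonical and dual is half of
    the dual.\<close>
  have "h_contraction (symmetric_conn ?D) \<sigma> \<nu> ?z = 1/2 * h_contraction (dual_conn ?D) \<sigma> \<nu> ?z"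
    "v_contraction (symmetric_conn ?D) \<sigma> \<nu> ?z = 1/2 * v_contraction (dual_conn ?D) \<sigma> \<nu> ?z"
    by (simp_all add: canonical.h_contraction_symmetric_conn[OF z] canonical.v_contraction_symmetric_conn[OF z]
        h_contraction_canonical[OF z] v_contraction_canonical[OF z])
  moreover have "h_contraction (dual_conn ?D) \<sigma> \<nu> ?z =
      h_cov ?D (h_torsion_trace ?D) \<sigma> \<nu> ?z - h_cov ?D (h_torsion_trace ?D) \<nu> \<sigma> ?z
      + (\<Sum>\<epsilon>\<in>UNIV. h_torsion_trace ?D \<epsilon> ?z * h_torsion ?D \<epsilon> \<sigma> \<nu> ?z)
      + (\<Sum>\<epsilon>\<in>UNIV. v_torsion_trace ?D \<epsilon> ?z * N_curvature (N c) \<epsilon> \<sigma> \<nu> ?z)"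
    unfolding canonical.h_contraction_dual_conn[OF z] h_contraction_canonical[OF z]
      h_cov_curl Nco by simp
  moreover have "v_contraction (dual_conn ?D) \<sigma> \<nu> ?z =
      v_cov ?D (v_torsion_trace ?D) \<sigma> \<nu> ?z - v_cov ?D (v_torsion_trace ?D) \<nu> \<sigma> ?z
      + (\<Sum>\<epsilon>\<in>UNIV. v_torsion_trace ?D \<epsilon> ?z * v_torsion ?D \<epsilon> \<sigma> \<nu> ?z)"
    unfolding canonical.v_contraction_dual_conn[OF z] v_contraction_canonical[OF z]
      v_cov_curl by simp
  ultimately show ?thesis
    unfolding Let_def using h_contraction_riemannian[OF z] v_contraction_riemannian[OF z] by blast
qed

end
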